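(* Let $\mathsf{C}$ be a locally finitely presentable category with the amalgamation property. If $\mathsf{C}$ satisfies WES, then $\mathsf{C}$ satisfies SES.
   Context: All categories are assumed to be locally small. An object $X$ of a category $\mathsf{C}$ is finitely presentable (respectively, finitely generated) if the functor $\mathsf{C}(X,-)\colon\mathsf{C}\to\mathsf{Set}$ preserves directed colimits (respectively, directed colimits of monomorphisms, i.e. colimits of directed diagrams all of whose connecting morphisms are monomorphisms). A category is locally finitely presentable if it is cocomplete and admits a (small) set $\mathsf{G}$ of finitely presentable objects such that every object is a directed colimit of objects from $\mathsf{G}$. A category has the amalgamation property if for any pair of monomorphisms $\alpha,\beta$ with common domain there are monomorphisms $\gamma,\delta$ with $\delta\circ\alpha=\gamma\circ\beta$. An epimorphism $e$ is extremal if, for any decomposition $e = m\circ f$ with $m$ a monomorphism, $m$ is an isomorphism. A category satisfies WES if every epimorphism between finitely generated objects is an extremal epimorphism. A category satisfies SES if every monomorphism is a regular monomorphism (an equaliser of some parallel pair). *)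

theory Defs
  imports Main "HOL-Library.FuncSet" "HOL-Library.Equipollence"
begin

text \<open>
  "Small" is meant relative to a universe, represented by a type \<open>'u\<close>: a set (over any type) is
  small if it has strictly fewer elements than \<open>'u\<close>. The predicate \<open>universe\<close> says that the
  cardinality of \<open>'u\<close> is infinite, strong limit and regular, as is that of a Grothendieck universe.
  (Uncountability is not demanded, so the universe of hereditarily finite sets is also allowed.)
  Up to bijection the small sets are exactly the small subsets of \<open>'u\<close>, so \<open>'u\<close> also serves to
  index small diagrams.
\<close>

definition small :: "'u itself \<Rightarrow> 'a set \<Rightarrow> bool" where
  "small U A \<longleftrightarrow> A \<prec> (UNIV :: 'u set)"

definition universe :: "'u itself \<Rightarrow> bool" where
  "universe U \<longleftrightarrow>
     infinite (UNIV :: 'u set) \<and>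
     (\<forall>A :: 'u set. small U A \<longrightarrow> small U (Pow A)) \<and>
     (\<forall>S :: 'u set set. small U S \<longrightarrow> (\<forall>A\<in>S. small U A) \<longrightarrow> small U (\<Union>S))"

record ('o, 'm) cat =
  Obj :: "'o set"
  Arr :: "'m set"
  Dom :: "'m \<Rightarrow> 'o"
  Cod :: "'m \<Rightarrow> 'o"
  Ide :: "'o \<Rightarrow> 'm"
  Comp :: "'m \<Rightarrow> 'm \<Rightarrow> 'm" (infixl "\<cdot>\<index>" 70)

definition hom :: "('o, 'm) cat \<Rightarrow> 'o \<Rightarrow> 'o \<Rightarrow> 'm set" where
  "hom C X Y = {f \<in> Arr C. Dom C f = X \<and> Cod C f = Y}"

locale category =
  fixes C :: "('o, 'm) cat" (structure)
  assumes Dom_in_Obj: "f \<in> Arr C \<Longrightarrow> Dom C f \<in> Obj C"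
    and Cod_in_Obj: "f \<in> Arr C \<Longrightarrow> Cod C f \<in> Obj C"
    and Ide_in_hom: "X \<in> Obj C \<Longrightarrow> Ide C X \<in> hom C X X"
    and Comp_in_hom: "\<lbrakk>f \<in> hom C X Y; g \<in> hom C Y Z\<rbrakk> \<Longrightarrow> g \<cdot> f \<in> hom C X Z"
    and Comp_Ide: "f \<in> hom C X Y \<Longrightarrow> f \<cdot> Ide C X = f"
    and Ide_Comp: "f \<in> hom C X Y \<Longrightarrow> Ide C Y \<cdot> f = f"
    and Comp_assoc: "\<lbrakk>f \<in> hom C W X; g \<in> hom C X Y; h \<in> hom C Y Z\<rbrakk> \<Longrightarrow> (h \<cdot> g) \<cdot> f = h \<cdot> (g \<cdot> f)"

definition locally_small :: "'u itself \<Rightarrow> ('o, 'm) cat \<Rightarrow> bool" where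
  "locally_small U C \<longleftrightarrow> (\<forall>X\<in>Obj C. \<forall>Y\<in>Obj C. small U (hom C X Y))"

record ('o, 'm, 'p, 'n) func =
  on_Obj :: "'o \<Rightarrow> 'p"
  on_Arr :: "'m \<Rightarrow> 'n"

definition is_functor :: "('o, 'm) cat \<Rightarrow> ('p, 'n) cat \<Rightarrow> ('o, 'm, 'p, 'n) func \<Rightarrow> bool" where
  "is_functor C D F \<longleftrightarrow>
     (\<forall>X\<in>Obj C. on_Obj F X \<in> Obj D) \<and>
     (\<forall>f\<in>Arr C. on_Arr F f \<in> hom D (on_Obj F (Dom C f)) (on_Obj F (Cod C f))) \<and>
     (\<forall>X\<in>Obj C. on_Arr F (Ide C X) = Ide D (on_Obj F X)) \<and>
     (\<forall>f\<in>Arr C. \<forall>g\<in>Arr C. Cod C f = Dom C g \<longrightarrow>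
        on_Arr F (g \<cdot>\<^bsub>C\<^esub> f) = on_Arr F g \<cdot>\<^bsub>D\<^esub> on_Arr F f)"

definition functor_comp ::
  "('p, 'n, 'q, 'k) func \<Rightarrow> ('o, 'm, 'p, 'n) func \<Rightarrow> ('o, 'm, 'q, 'k) func" where
  "functor_comp G F = \<lparr>on_Obj = on_Obj G \<circ> on_Obj F, on_Arr = on_Arr G \<circ> on_Arr F\<rparr>"

definition is_cocone ::
  "('i, 'j) cat \<Rightarrow> ('o, 'm) cat \<Rightarrow> ('i, 'j, 'o, 'm) func \<Rightarrow> 'o \<Rightarrow> ('i \<Rightarrow> 'm) \<Rightarrow> bool" where
  "is_cocone J C F X t \<longleftrightarrow>
     X \<in> Obj C \<and>
     (\<forall>i\<in>Obj J. t i \<in> hom C (on_Obj F i) X) \<and>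
     (\<forall>u\<in>Arr J. t (Cod J u) \<cdot>\<^bsub>C\<^esub> on_Arr F u = t (Dom J u))"

definition is_colimit ::
  "('i, 'j) cat \<Rightarrow> ('o, 'm) cat \<Rightarrow> ('i, 'j, 'o, 'm) func \<Rightarrow> 'o \<Rightarrow> ('i \<Rightarrow> 'm) \<Rightarrow> bool" where
  "is_colimit J C F X t \<longleftrightarrow>
     is_cocone J C F X t \<and>
     (\<forall>Y s. is_cocone J C F Y s \<longrightarrow>
        (\<exists>!h. h \<in> hom C X Y \<and> (\<forall>i\<in>Obj J. h \<cdot>\<^bsub>C\<^esub> t i = s i)))"

text \<open>
  A category with a small set of arrows has a small set of objects, hence is isomorphic to one
  with objects and arrows in \<open>'u\<close>.
\<close>

definition cocomplete :: "'u itself \<Rightarrow> ('o, 'm) cat \<Rightarrow> bool" where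
  "cocomplete U C \<longleftrightarrow>
     (\<forall>(J :: ('u, 'u) cat) F. category J \<longrightarrow> small U (Arr J) \<longrightarrow> is_functor J C F \<longrightarrow>
        (\<exists>X t. is_colimit J C F X t))"

definition preserves_colimits_of ::
  "('i, 'j) cat \<Rightarrow> ('i, 'j, 'o, 'm) func \<Rightarrow> ('o, 'm) cat \<Rightarrow> ('p, 'n) cat \<Rightarrow>
   ('o, 'm, 'p, 'n) func \<Rightarrow> bool" where
  "preserves_colimits_of J F C D G \<longleftrightarrow>
     (\<forall>X t. is_colimit J C F X t \<longrightarrow>
        is_colimit J D (functor_comp G F) (on_Obj G X) (on_Arr G \<circ> t))"

definition directed_poset :: "'i set \<Rightarrow> ('i \<times> 'i) set \<Rightarrow> bool" where
  "directed_poset I r \<longleftrightarrow>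
     I \<noteq> {} \<and> partial_order_on I r \<and>
     (\<forall>i\<in>I. \<forall>j\<in>I. \<exists>k\<in>I. (i, k) \<in> r \<and> (j, k) \<in> r)"

definition poset_cat :: "'i set \<Rightarrow> ('i \<times> 'i) set \<Rightarrow> ('i, 'i \<times> 'i) cat" where
  "poset_cat I r =
     \<lparr>Obj = I, Arr = r, Dom = fst, Cod = snd, Ide = (\<lambda>i. (i, i)),
      Comp = (\<lambda>g f. (fst f, snd g))\<rparr>"

definition directed_diagram ::
  "'u itself \<Rightarrow> ('o, 'm) cat \<Rightarrow> 'u set \<Rightarrow> ('u \<times> 'u) set \<Rightarrow> ('u, 'u \<times> 'u, 'o, 'm) func \<Rightarrow> bool" where
  "directed_diagram U C I r F \<longleftrightarrow>
     small U I \<and> directed_poset I r \<and> is_functor (poset_cat I r) C F"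

text \<open>
  The category of small sets with elements in \<open>'x\<close>. Arrows \<open>(A, f, B)\<close> carry their source and
  target; \<open>f\<close> is extensional so that equality of arrows is equality of functions on \<open>A\<close>.
\<close>

definition set_cat :: "'u itself \<Rightarrow> ('x set, 'x set \<times> ('x \<Rightarrow> 'x) \<times> 'x set) cat" where
  "set_cat U =
     \<lparr>Obj = {A. small U A},
      Arr = {(A, f, B). small U A \<and> small U B \<and> f \<in> A \<rightarrow>\<^sub>E B},
      Dom = (\<lambda>(A, f, B). A),
      Cod = (\<lambda>(A, f, B). B),
      Ide = (\<lambda>A. (A, \<lambda>x\<in>A. x, A)),
      Comp = (\<lambda>(B', g, D) (A, f, B). (A, compose A g f, D))\<rparr>"

text \<open>
  The functor \<open>C(X, -)\<close> into sets. The sets have elements in \<open>'u + 'm\<close>, with arrows of \<open>C\<close>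
  embedded by \<open>Inr\<close>, because the subsets of \<open>'m\<close> alone need not represent all small sets up to
  bijection, whereas those of \<open>'u + 'm\<close> do.
\<close>

definition hom_set :: "'u itself \<Rightarrow> ('o, 'm) cat \<Rightarrow> 'o \<Rightarrow> 'o \<Rightarrow> ('u + 'm) set" where
  "hom_set U C X Y = Inr ` hom C X Y"

definition hom_functor ::
  "'u itself \<Rightarrow> ('o, 'm) cat \<Rightarrow> 'o \<Rightarrow>
   ('o, 'm, ('u + 'm) set, ('u + 'm) set \<times> ('u + 'm \<Rightarrow> 'u + 'm) \<times> ('u + 'm) set) func" where
  "hom_functor U C X =
     \<lparr>on_Obj = hom_set U C X,
      on_Arr = (\<lambda>f. (hom_set U C X (Dom C f),
                     \<lambda>z\<in>hom_set U C X (Dom C f). Inr (f \<cdot>\<^bsub>C\<^esub> projr z),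
                     hom_set U C X (Cod C f)))\<rparr>"

definition monomorphism :: "('o, 'm) cat \<Rightarrow> 'm \<Rightarrow> bool" where
  "monomorphism C m \<longleftrightarrow>
     m \<in> Arr C \<and>
     (\<forall>W. \<forall>f\<in>hom C W (Dom C m). \<forall>g\<in>hom C W (Dom C m). m \<cdot>\<^bsub>C\<^esub> f = m \<cdot>\<^bsub>C\<^esub> g \<longrightarrow> f = g)"

definition epimorphism :: "('o, 'm) cat \<Rightarrow> 'm \<Rightarrow> bool" where
  "epimorphism C e \<longleftrightarrow>
     e \<in> Arr C \<and>
     (\<forall>Z. \<forall>f\<in>hom C (Cod C e) Z. \<forall>g\<in>hom C (Cod C e) Z. f \<cdot>\<^bsub>C\<^esub> e = g \<cdot>\<^bsub>C\<^esub> e \<longrightarrow> f = g)"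

definition isomorphism :: "('o, 'm) cat \<Rightarrow> 'm \<Rightarrow> bool" where
  "isomorphism C f \<longleftrightarrow>
     f \<in> Arr C \<and>
     (\<exists>g\<in>hom C (Cod C f) (Dom C f). g \<cdot>\<^bsub>C\<^esub> f = Ide C (Dom C f) \<and> f \<cdot>\<^bsub>C\<^esub> g = Ide C (Cod C f))"

definition extremal_epi :: "('o, 'm) cat \<Rightarrow> 'm \<Rightarrow> bool" where
  "extremal_epi C e \<longleftrightarrow>
     epimorphism C e \<and>
     (\<forall>m f. monomorphism C m \<longrightarrow> f \<in> hom C (Dom C e) (Dom C m) \<longrightarrow> e = m \<cdot>\<^bsub>C\<^esub> f \<longrightarrow> isomorphism C m)"

definition is_equaliser :: "('o, 'm) cat \<Rightarrow> 'm \<Rightarrow> 'm \<Rightarrow> 'm \<Rightarrow> bool" where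
  "is_equaliser C m f g \<longleftrightarrow>
     f \<in> Arr C \<and> g \<in> Arr C \<and> Dom C f = Dom C g \<and> Cod C f = Cod C g \<and>
     m \<in> hom C (Dom C m) (Dom C f) \<and> f \<cdot>\<^bsub>C\<^esub> m = g \<cdot>\<^bsub>C\<^esub> m \<and>
     (\<forall>W. \<forall>h\<in>hom C W (Dom C f). f \<cdot>\<^bsub>C\<^esub> h = g \<cdot>\<^bsub>C\<^esub> h \<longrightarrow>
        (\<exists>!k. k \<in> hom C W (Dom C m) \<and> m \<cdot>\<^bsub>C\<^esub> k = h))"

definition regular_mono :: "('o, 'm) cat \<Rightarrow> 'm \<Rightarrow> bool" where
  "regular_mono C m \<longleftrightarrow> (\<exists>f g. is_equaliser C m f g)"

definition finitely_presentable :: "'u itself \<Rightarrow> ('o, 'm) cat \<Rightarrow> 'o \<Rightarrow> bool" where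
  "finitely_presentable U C X \<longleftrightarrow>
     X \<in> Obj C \<and>
     (\<forall>I r F. directed_diagram U C I r F \<longrightarrow>
        preserves_colimits_of (poset_cat I r) F C (set_cat U) (hom_functor U C X))"

definition finitely_generated :: "'u itself \<Rightarrow> ('o, 'm) cat \<Rightarrow> 'o \<Rightarrow> bool" where
  "finitely_generated U C X \<longleftrightarrow>
     X \<in> Obj C \<and>
     (\<forall>I r F. directed_diagram U C I r F \<longrightarrow> (\<forall>u\<in>r. monomorphism C (on_Arr F u)) \<longrightarrow>
        preserves_colimits_of (poset_cat I r) F C (set_cat U) (hom_functor U C X))"

definition locally_finitely_presentable :: "'u itself \<Rightarrow> ('o, 'm) cat \<Rightarrow> bool" where
  "locally_finitely_presentable U C \<longleftrightarrow>
     cocomplete U C \<and>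
     (\<exists>G. small U G \<and> (\<forall>X\<in>G. finitely_presentable U C X) \<and>
        (\<forall>X\<in>Obj C. \<exists>I r F t. directed_diagram U C I r F \<and> (\<forall>i\<in>I. on_Obj F i \<in> G) \<and>
           is_colimit (poset_cat I r) C F X t))"

definition amalgamation_property :: "('o, 'm) cat \<Rightarrow> bool" where
  "amalgamation_property C \<longleftrightarrow>
     (\<forall>\<alpha> \<beta>. monomorphism C \<alpha> \<longrightarrow> monomorphism C \<beta> \<longrightarrow> Dom C \<alpha> = Dom C \<beta> \<longrightarrow>
        (\<exists>\<gamma> \<delta>. monomorphism C \<gamma> \<and> monomorphism C \<delta> \<and> Dom C \<delta> = Cod C \<alpha> \<and> Dom C \<gamma> = Cod C \<beta> \<and>
           Cod C \<delta> = Cod C \<gamma> \<and> \<delta> \<cdot>\<^bsub>C\<^esub> \<alpha> = \<gamma> \<cdot>\<^bsub>C\<^esub> \<beta>))"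

definition WES :: "'u itself \<Rightarrow> ('o, 'm) cat \<Rightarrow> bool" where
  "WES U C \<longleftrightarrow>
     (\<forall>e. epimorphism C e \<longrightarrow> finitely_generated U C (Dom C e) \<longrightarrow> finitely_generated U C (Cod C e) \<longrightarrow>
        extremal_epi C e)"

definition SES :: "('o, 'm) cat \<Rightarrow> bool" where
  "SES C \<longleftrightarrow> (\<forall>m. monomorphism C m \<longrightarrow> regular_mono C m)"

lemma category_poset_cat:
  assumes "directed_poset I r"
  shows "category (poset_cat I r)"
  using assms
  by unfold_locales
     (auto simp: directed_poset_def poset_cat_def hom_def partial_order_on_def preorder_on_def
        intro: refl_onD transD)

lemma category_set_cat: "category (set_cat U)"
proof
  fix f X Y assume "f \<in> hom (set_cat U) X Y"
  then show "Comp (set_cat U) f (Ide (set_cat U) X) = f" "Comp (set_cat U) (Ide (set_cat U) Y) f = f"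
    by (auto simp: set_cat_def hom_def compose_def PiE_def extensional_def fun_eq_iff)
qed (auto simp: set_cat_def hom_def compose_def fun_eq_iff PiE_iff extensional_def)

lemma small_image: "small U A \<Longrightarrow> small U (f ` A)"
  unfolding small_def by (metis image_lepoll lesspoll_trans1)

lemma is_functor_hom_functor:
  fixes U :: "'u itself"
  assumes "category C" "locally_small U C" "X \<in> Obj C"
  shows "is_functor C (set_cat U) (hom_functor U C X)"
proof -
  interpret category C by fact
  have s: "small U (hom_set U C X Y)" if "Y \<in> Obj C" for Y
    using assms that by (auto simp: hom_set_def locally_small_def intro: small_image)
  have hom: "f \<in> hom C (Dom C f) (Cod C f)" if "f \<in> Arr C" for f
    using that by (simp add: hom_def)
  have comp: "Comp C f k \<in> hom C X (Cod C f)" if "f \<in> Arr C" "k \<in> hom C X (Dom C f)" for f k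
    using Comp_in_hom[OF that(2) hom[OF that(1)]] .
  have D: "Dom C (Comp C g f) = Dom C f \<and> Cod C (Comp C g f) = Cod C g"
    if "f \<in> Arr C" "g \<in> Arr C" "Cod C f = Dom C g" for f g
    using Comp_in_hom[of f "Dom C f" "Dom C g" g "Cod C g"] that by (simp add: hom_def)
  have I: "Dom C (Ide C Y) = Y \<and> Cod C (Ide C Y) = Y" if "Y \<in> Obj C" for Y
    using Ide_in_hom[OF that] by (simp add: hom_def)
  show ?thesis
    unfolding is_functor_def
  proof (intro conjI ballI impI)
    fix Y assume Y: "Y \<in> Obj C"
    show "on_Obj (hom_functor U C X) Y \<in> Obj (set_cat U)"
      using s[OF Y] by (simp add: hom_functor_def set_cat_def)
    show "on_Arr (hom_functor U C X) (Ide C Y) = Ide (set_cat U) (on_Obj (hom_functor U C X) Y)"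
      using I[OF Y] Ide_Comp
      by (auto simp: hom_functor_def set_cat_def hom_set_def fun_eq_iff restrict_def)
  next
    fix f assume f: "f \<in> Arr C"
    show "on_Arr (hom_functor U C X) f
       \<in> hom (set_cat U) (on_Obj (hom_functor U C X) (Dom C f)) (on_Obj (hom_functor U C X) (Cod C f))"
      using s[OF Dom_in_Obj[OF f]] s[OF Cod_in_Obj[OF f]] comp[OF f]
      by (auto simp: hom_functor_def set_cat_def hom_def[of "\<lparr>Obj = _, Arr = _, Dom = _, Cod = _, Ide = _, Comp = _\<rparr>"] hom_set_def)
  next
    fix f g assume fg: "f \<in> Arr C" "g \<in> Arr C" "Cod C f = Dom C g"
    show "on_Arr (hom_functor U C X) (Comp C g f)
       = Comp (set_cat U) (on_Arr (hom_functor U C X) g) (on_Arr (hom_functor U C X) f)"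
      using D[OF fg] comp[OF fg(1)] fg Comp_assoc[OF _ hom[OF fg(1)], of _ X g "Cod C g"] hom[OF fg(2)]
      by (auto simp: hom_functor_def set_cat_def hom_set_def fun_eq_iff compose_def restrict_def)
  qed
qed

end

theory Submission
  imports Defs
begin

text \<open>
  A monomorphism \<open>m : A \<rightarrow> B\<close> is shown to be the equaliser of its cokernel pair \<open>p, q : B \<rightarrow> P\<close>. As
  every object is a colimit of finitely presentable generators \<open>g\<close>, it suffices to factor through
  \<open>m\<close> each \<open>b : g \<rightarrow> B\<close> with \<open>p \<cdot> b = q \<cdot> b\<close>; in the language of algebra, each \<open>b\<close> in the dominion
  of \<open>A\<close> in \<open>B\<close>.

  The condition \<open>p \<cdot> b = q \<cdot> b\<close> is finitary (\<open>dominion_finitary\<close>). If \<open>A\<close> is the directed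
  colimit of generators \<open>A j\<close>, then \<open>P\<close> is the directed colimit of the cokernel pairs of the
  composites \<open>A j \<rightarrow> A \<rightarrow> B\<close>, so \<open>b\<close> is already in the dominion of some \<open>A j\<close>. Hence \<open>A\<close> may be
  replaced by the image \<open>A'\<close> of \<open>A j\<close>, which is finitely generated. Let \<open>D\<close> be the subobject of
  \<open>B\<close> generated by \<open>A'\<close> and \<open>b\<close>, again finitely generated. The amalgamation property makes
  \<open>A' \<rightarrow> D\<close> an epimorphism (\<open>epi_into_dominion\<close>): the two legs of its cokernel pair are split
  monomorphisms, so after a monomorphism they extend along \<open>D \<rightarrow> B\<close> to two arrows on \<open>B\<close> that agree
  on \<open>A'\<close>, hence on \<open>b\<close>, hence on all of \<open>D\<close>. By WES this epimorphism is extremal, and being a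
  monomorphism it is invertible. So \<open>b\<close> factors through \<open>A'\<close>, and thus through \<open>m\<close>.

  The images used here are factorisations into a strong epimorphism and a monomorphism
  (\<open>image_factorisation\<close>). They are obtained without limits: coequalise all pairs of arrows from
  generators that become equal in the codomain, repeat this, and take the colimit of the resulting
  sequence. Finite presentability of the generators makes \<open>\<omega>\<close> steps suffice. In the universe of
  hereditarily finite sets cocompleteness provides no colimits of sequences, but there all small
  sets are finite and a counting argument shows that some finite stage suffices.
\<close>


section \<open>Small sets\<close>

lemma small_subset: "small U B \<Longrightarrow> A \<subseteq> B \<Longrightarrow> small U A"
  unfolding small_def by (meson lesspoll_trans1 subset_imp_lepoll)

lemma small_finite: "universe (U :: 'u itself) \<Longrightarrow> finite A \<Longrightarrow> small U A"
  by (simp add: small_def universe_def finite_lesspoll_infinite)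

lemma small_embedding:
  assumes "small (U :: 'u itself) A"
  obtains \<phi> :: "'a \<Rightarrow> 'u" where "inj_on \<phi> A"
  using assms unfolding small_def lesspoll_def lepoll_def by blast

lemma universe_two_points:
  assumes "universe (U :: 'u itself)"
  obtains a b :: 'u where "a \<noteq> b"
proof -
  have "infinite (UNIV :: 'u set)"
    using assms by (simp add: universe_def)
  then obtain b :: 'u where "b \<notin> {undefined}"
    by (metis ex_new_if_finite finite.emptyI finite.insertI)
  then show thesis
    using that by blast
qed

text \<open>
  The closure of the universe under small unions concerns sets of elements of \<open>'u\<close>. For arbitrary
  sets \<open>A i\<close>, embed the disjoint union into \<open>'u\<close> by means of \<open>'u \<times> 'u \<cong> 'u\<close>.
\<close>

lemma small_UN:
  fixes U :: "'u itself" and A :: "'i \<Rightarrow> 'a set"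
  assumes U: "universe U" and I: "small U I" and A: "\<And>i. i \<in> I \<Longrightarrow> small U (A i)"
  shows "small U (\<Union>i\<in>I. A i)"
proof -
  have "infinite (UNIV :: 'u set)"
    using U by (simp add: universe_def)
  then obtain \<pi> :: "'u \<times> 'u \<Rightarrow> 'u" where \<pi>: "inj \<pi>"
    by (metis card_of_Times_same_infinite card_of_ordIso bij_betw_def UNIV_Times_UNIV)
  obtain \<psi> :: "'i \<Rightarrow> 'u" where \<psi>: "inj_on \<psi> I"
    using I small_embedding by blast
  have "\<exists>\<phi> :: 'a \<Rightarrow> 'u. inj_on \<phi> (A i)" if "i \<in> I" for i
    using small_embedding[OF A[OF that]] by blast
  then obtain \<phi> :: "'i \<Rightarrow> 'a \<Rightarrow> 'u" where \<phi>: "\<And>i. i \<in> I \<Longrightarrow> inj_on (\<phi> i) (A i)"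
    by metis
  define B where "B i = (\<lambda>a. \<pi> (\<psi> i, \<phi> i a)) ` A i" for i
  have "small U (\<Union>(B ` I))"
    using U small_image[OF I, of B] small_image[OF A] unfolding universe_def B_def by blast
  moreover define g where
    "g z = (SOME a. \<exists>i\<in>I. a \<in> A i \<and> z = \<pi> (\<psi> i, \<phi> i a))" for z
  have "g (\<pi> (\<psi> i, \<phi> i a)) = a" if "i \<in> I" "a \<in> A i" for i a
    unfolding g_def
  proof (rule some_equality)
    fix a' assume "\<exists>i'\<in>I. a' \<in> A i' \<and> \<pi> (\<psi> i, \<phi> i a) = \<pi> (\<psi> i', \<phi> i' a')"
    then show "a' = a"
      using that \<pi> \<psi> \<phi> by (metis injD inj_onD prod.inject)
  qed (use that in blast)
  then have "(\<Union>i\<in>I. A i) \<subseteq> g ` \<Union>(B ` I)"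
    unfolding B_def by (force simp: image_iff)
  ultimately show ?thesis
    by (rule small_subset[OF small_image])
qed

lemma small_Un:
  assumes "universe (U :: 'u itself)" "small U A" "small U B"
  shows "small U (A \<union> B)"
proof -
  have "small U (\<Union>b\<in>UNIV. if b then A else B)"
    using assms by (intro small_UN) (auto intro: small_finite)
  then show ?thesis
    by (simp add: UNIV_bool Un_commute)
qed

lemma small_Times:
  assumes "universe (U :: 'u itself)" "small U A" "small U B"
  shows "small U (A \<times> B)"
proof -
  have "small U (\<Union>a\<in>A. Pair a ` B)"
    using assms by (intro small_UN) (auto intro: small_image)
  then show ?thesis
    by (rule small_subset) auto
qed

section \<open>Arrows\<close>

lemma hom_ArrD: "f \<in> hom C X Y \<Longrightarrow> f \<in> Arr C \<and> Dom C f = X \<and> Cod C f = Y"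
  by (simp add: hom_def)

lemma hom_Dom_Cod: "f \<in> Arr C \<Longrightarrow> f \<in> hom C (Dom C f) (Cod C f)"
  by (simp add: hom_def)

lemma functorD:
  assumes "is_functor J C F"
  shows "X \<in> Obj J \<Longrightarrow> on_Obj F X \<in> Obj C"
    and "f \<in> Arr J \<Longrightarrow> on_Arr F f \<in> hom C (on_Obj F (Dom J f)) (on_Obj F (Cod J f))"
    and "X \<in> Obj J \<Longrightarrow> on_Arr F (Ide J X) = Ide C (on_Obj F X)"
    and "\<lbrakk>f \<in> Arr J; g \<in> Arr J; Cod J f = Dom J g\<rbrakk> \<Longrightarrow>
      on_Arr F (g \<cdot>\<^bsub>J\<^esub> f) = on_Arr F g \<cdot>\<^bsub>C\<^esub> on_Arr F f"
  using assms unfolding is_functor_def by blast+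

lemma colimit_desc:
  assumes "is_colimit J C F X t" "is_cocone J C F Y s"
  obtains h where "h \<in> hom C X Y" "\<And>i. i \<in> Obj J \<Longrightarrow> h \<cdot>\<^bsub>C\<^esub> t i = s i"
  using assms unfolding is_colimit_def by metis

lemma colimit_cocone:
  assumes "is_colimit J C F X t"
  shows "X \<in> Obj C"
    and "i \<in> Obj J \<Longrightarrow> t i \<in> hom C (on_Obj F i) X"
    and "u \<in> Arr J \<Longrightarrow> t (Cod J u) \<cdot>\<^bsub>C\<^esub> on_Arr F u = t (Dom J u)"
  using assms unfolding is_colimit_def is_cocone_def by blast+

context category
begin

lemma hom_Obj:
  assumes "f \<in> hom C X Y" shows "X \<in> Obj C" "Y \<in> Obj C"
  using assms Dom_in_Obj Cod_in_Obj unfolding hom_def by blast+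

lemma monoD:
  assumes "monomorphism C m" "m \<in> hom C X Y" "f \<in> hom C W X" "g \<in> hom C W X" "m \<cdot> f = m \<cdot> g"
  shows "f = g"
  using assms hom_ArrD[OF assms(2)] unfolding monomorphism_def by blast

lemma monoI:
  assumes "m \<in> hom C X Y"
    and "\<And>W f g. f \<in> hom C W X \<Longrightarrow> g \<in> hom C W X \<Longrightarrow> m \<cdot> f = m \<cdot> g \<Longrightarrow> f = g"
  shows "monomorphism C m"
  using assms hom_ArrD[OF assms(1)] unfolding monomorphism_def by blast

lemma epiD:
  assumes "epimorphism C e" "e \<in> hom C X Y" "f \<in> hom C Y Z" "g \<in> hom C Y Z" "f \<cdot> e = g \<cdot> e"
  shows "f = g"
  using assms hom_ArrD[OF assms(2)] unfolding epimorphism_def by blast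

lemma epiI:
  assumes "e \<in> hom C X Y"
    and "\<And>Z f g. f \<in> hom C Y Z \<Longrightarrow> g \<in> hom C Y Z \<Longrightarrow> f \<cdot> e = g \<cdot> e \<Longrightarrow> f = g"
  shows "epimorphism C e"
  using assms hom_ArrD[OF assms(1)] unfolding epimorphism_def by blast

text \<open>Rewriting at the head of a composite that is bracketed to the right.\<close>

lemma Comp_eq_assoc:
  assumes "g \<cdot> f = k" "f \<in> hom C X Y" "g \<in> hom C Y Z" "x \<in> hom C W X"
  shows "g \<cdot> (f \<cdot> x) = k \<cdot> x"
  using Comp_assoc[OF assms(4,2,3)] assms(1) by simp

lemma mono_Comp:
  assumes m: "monomorphism C m" "m \<in> hom C X Y" and n: "monomorphism C n" "n \<in> hom C Y Z"
  shows "monomorphism C (n \<cdot> m)"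
proof (rule monoI[OF Comp_in_hom[OF m(2) n(2)]])
  fix W f g assume f: "f \<in> hom C W X" and g: "g \<in> hom C W X" and eq: "n \<cdot> m \<cdot> f = n \<cdot> m \<cdot> g"
  have "n \<cdot> (m \<cdot> f) = n \<cdot> (m \<cdot> g)"
    using eq Comp_assoc[OF f m(2) n(2)] Comp_assoc[OF g m(2) n(2)] by simp
  then have "m \<cdot> f = m \<cdot> g"
    by (rule monoD[OF n Comp_in_hom[OF f m(2)] Comp_in_hom[OF g m(2)]])
  then show "f = g"
    by (rule monoD[OF m f g])
qed

lemma mono_right_factor:
  assumes nm: "monomorphism C (n \<cdot> m)" and m: "m \<in> hom C X Y" and n: "n \<in> hom C Y Z"
  shows "monomorphism C m"
proof (rule monoI[OF m])
  fix W f g assume f: "f \<in> hom C W X" and g: "g \<in> hom C W X" and eq: "m \<cdot> f = m \<cdot> g"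
  have "n \<cdot> m \<cdot> f = n \<cdot> m \<cdot> g"
    using eq Comp_assoc[OF f m n] Comp_assoc[OF g m n] by simp
  then show "f = g"
    by (rule monoD[OF nm Comp_in_hom[OF m n] f g])
qed

lemma split_mono:
  assumes m: "m \<in> hom C X Y" and n: "n \<in> hom C Y X" and nm: "n \<cdot> m = Ide C X"
  shows "monomorphism C m"
proof (rule monoI[OF m])
  fix W f g assume f: "f \<in> hom C W X" and g: "g \<in> hom C W X" and eq: "m \<cdot> f = m \<cdot> g"
  show "f = g"
    using Comp_eq_assoc[OF nm m n f] Comp_eq_assoc[OF nm m n g] Ide_Comp[OF f] Ide_Comp[OF g]
    unfolding eq by simp
qed

lemma colimit_eqI:
  assumes X: "is_colimit J C F X t" and J: "category J" and F: "is_functor J C F"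
    and f: "f \<in> hom C X Y" and g: "g \<in> hom C X Y"
    and eq: "\<And>i. i \<in> Obj J \<Longrightarrow> f \<cdot> t i = g \<cdot> t i"
  shows "f = g"
proof -
  interpret J: category J by fact
  note t = colimit_cocone[OF X]
  have "is_cocone J C F Y (\<lambda>i. f \<cdot> t i)"
    unfolding is_cocone_def
  proof (intro conjI ballI)
    show "Y \<in> Obj C" using f hom_Obj by blast
    show "f \<cdot> t i \<in> hom C (on_Obj F i) Y" if "i \<in> Obj J" for i
      using Comp_in_hom[OF t(2)[OF that] f] .
    show "f \<cdot> t (Cod J u) \<cdot> on_Arr F u = f \<cdot> t (Dom J u)" if "u \<in> Arr J" for u
      using Comp_assoc[OF functorD(2)[OF F that] t(2)[OF J.Cod_in_Obj[OF that]] f] t(3)[OF that]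
      by simp
  qed
  then show ?thesis
    using X f g eq unfolding is_colimit_def by metis
qed

end

section \<open>Colimits from cocompleteness\<close>

text \<open>
  Cocompleteness speaks of shapes inside the universe; every small shape is isomorphic to one of
  those, and its colimits can be computed there.
\<close>

lemma colimit_small_shape:
  fixes U :: "'u itself" and J :: "('i, 'j) cat"
  assumes J: "category J" and small: "small U (Arr J)"
    and C: "category C" "cocomplete U C" and F: "is_functor J C F"
  obtains X t where "is_colimit J C F X t"
proof -
  interpret J: category J by fact
  have "Obj J \<subseteq> Dom J ` Arr J"
    using J.Ide_in_hom unfolding hom_def by force
  then have "small U (Obj J)"
    by (rule small_subset[OF small_image[OF small]])
  then obtain \<phi> :: "'i \<Rightarrow> 'u" where \<phi>: "inj_on \<phi> (Obj J)"
    using small_embedding by blast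
  obtain \<psi> :: "'j \<Rightarrow> 'u" where \<psi>: "inj_on \<psi> (Arr J)"
    using small small_embedding by blast
  define \<phi>' where "\<phi>' = inv_into (Obj J) \<phi>"
  define \<psi>' where "\<psi>' = inv_into (Arr J) \<psi>"
  have [simp]: "\<phi>' (\<phi> i) = i" if "i \<in> Obj J" for i
    using that \<phi> by (simp add: \<phi>'_def)
  have [simp]: "\<psi>' (\<psi> u) = u" if "u \<in> Arr J" for u
    using that \<psi> by (simp add: \<psi>'_def)
  have [simp]: "Dom J (Ide J i) = i" "Cod J (Ide J i) = i" "Ide J i \<in> Arr J" if "i \<in> Obj J" for i
    using J.Ide_in_hom[OF that] by (auto simp: hom_def)
  have [simp]: "Dom J u \<in> Obj J" "Cod J u \<in> Obj J" if "u \<in> Arr J" for u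
    using that J.Dom_in_Obj J.Cod_in_Obj by auto
  have comp: "v \<cdot>\<^bsub>J\<^esub> u \<in> Arr J \<and> Dom J (v \<cdot>\<^bsub>J\<^esub> u) = Dom J u \<and> Cod J (v \<cdot>\<^bsub>J\<^esub> u) = Cod J v"
    if "u \<in> Arr J" "v \<in> Arr J" "Cod J u = Dom J v" for u v
    using J.Comp_in_hom[of u "Dom J u" "Dom J v" v "Cod J v"] that by (auto simp: hom_def)
  have unit: "u \<cdot>\<^bsub>J\<^esub> Ide J (Dom J u) = u" "Ide J (Cod J u) \<cdot>\<^bsub>J\<^esub> u = u" if "u \<in> Arr J" for u
    using J.Comp_Ide J.Ide_Comp hom_Dom_Cod[OF that] by metis+
  define K :: "('u, 'u) cat" where
    "K = \<lparr>Obj = \<phi> ` Obj J, Arr = \<psi> ` Arr J, Dom = \<lambda>u. \<phi> (Dom J (\<psi>' u)),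
      Cod = \<lambda>u. \<phi> (Cod J (\<psi>' u)), Ide = \<lambda>i. \<psi> (Ide J (\<phi>' i)),
      Comp = \<lambda>v u. \<psi> (\<psi>' v \<cdot>\<^bsub>J\<^esub> \<psi>' u)\<rparr>"
  have inj: "\<phi> i = \<phi> j \<longleftrightarrow> i = j" if "i \<in> Obj J" "j \<in> Obj J" for i j
    using \<phi> that by (auto simp: inj_on_def)
  have K: "category K"
  proof unfold_locales
    fix f W X g Y h Z
    assume "f \<in> hom K W X" "g \<in> hom K X Y" "h \<in> hom K Y Z"
    then show "h \<cdot>\<^bsub>K\<^esub> g \<cdot>\<^bsub>K\<^esub> f = h \<cdot>\<^bsub>K\<^esub> (g \<cdot>\<^bsub>K\<^esub> f)"
      using J.Comp_assoc[of "\<psi>' f" _ _ "\<psi>' g" _ "\<psi>' h"]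
      by (auto simp: K_def hom_def inj comp)
  qed (auto simp: K_def hom_def inj comp unit)
  define F' where "F' = \<lparr>on_Obj = on_Obj F \<circ> \<phi>', on_Arr = on_Arr F \<circ> \<psi>'\<rparr>"
  have F': "is_functor K C F'"
    unfolding is_functor_def
    using functorD[OF F] by (auto simp: K_def F'_def inj comp)
  have "small U (Arr K)"
    using small_image[OF small] by (simp add: K_def)
  then obtain X t where X: "is_colimit K C F' X t"
    using C(2) K F' unfolding cocomplete_def by blast
  have cocone: "is_cocone K C F' Y s \<longleftrightarrow> is_cocone J C F Y (s \<circ> \<phi>)" for Y s
    by (simp add: is_cocone_def K_def F'_def)
  have cocone': "is_cocone J C F Y s \<longleftrightarrow> is_cocone K C F' Y (s \<circ> \<phi>')" for Y s
    by (simp add: is_cocone_def K_def F'_def)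
  have "is_colimit J C F X (t \<circ> \<phi>)"
    unfolding is_colimit_def
  proof (intro conjI allI impI)
    show "is_cocone J C F X (t \<circ> \<phi>)"
      using X cocone unfolding is_colimit_def by blast
    fix Y s assume "is_cocone J C F Y s"
    then have "\<exists>!h. h \<in> hom C X Y \<and> (\<forall>i\<in>Obj K. h \<cdot>\<^bsub>C\<^esub> t i = (s \<circ> \<phi>') i)"
      using X cocone' unfolding is_colimit_def by blast
    then show "\<exists>!h. h \<in> hom C X Y \<and> (\<forall>i\<in>Obj J. h \<cdot>\<^bsub>C\<^esub> (t \<circ> \<phi>) i = s i)"
      by (simp add: K_def)
  qed
  then show thesis
    using that by blast
qed

text \<open>
  Coproducts, cokernel pairs and joint coequalisers are all given by objects \<open>D i\<close> subject to
  equations \<open>t i \<cdot> x = t j \<cdot> y\<close>. The shape has an object for each index and for each equation and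
  two arrows from each equation, so none of its composites is nontrivial.
\<close>

lemma colimit_of_equations:
  fixes U :: "'u itself" and C :: "('o, 'm) cat" (structure) and D :: "'i \<Rightarrow> 'o"
    and R :: "('i \<times> 'm \<times> 'i \<times> 'm) set"
  assumes U: "universe U" and C: "category C" "cocomplete U C"
    and I: "small U I" and R: "small U R"
    and D: "\<And>i. i \<in> I \<Longrightarrow> D i \<in> Obj C"
    and eqs: "\<And>i x j y. (i, x, j, y) \<in> R \<Longrightarrow>
      i \<in> I \<and> j \<in> I \<and> (\<exists>W. x \<in> hom C W (D i) \<and> y \<in> hom C W (D j))"
  obtains Q t where "\<And>i. i \<in> I \<Longrightarrow> t i \<in> hom C (D i) Q" and "Q \<in> Obj C"
    and "\<And>i x j y. (i, x, j, y) \<in> R \<Longrightarrow> t i \<cdot> x = t j \<cdot> y"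
    and "\<And>Z s. \<lbrakk>Z \<in> Obj C; \<And>i. i \<in> I \<Longrightarrow> s i \<in> hom C (D i) Z;
        \<And>i x j y. (i, x, j, y) \<in> R \<Longrightarrow> s i \<cdot> x = s j \<cdot> y\<rbrakk> \<Longrightarrow>
      \<exists>h. h \<in> hom C Q Z \<and> (\<forall>i\<in>I. h \<cdot> t i = s i)"
    and "\<And>Z f g. \<lbrakk>f \<in> hom C Q Z; g \<in> hom C Q Z; \<And>i. i \<in> I \<Longrightarrow> f \<cdot> t i = g \<cdot> t i\<rbrakk> \<Longrightarrow>
      f = g"
proof -
  interpret category C by fact
  let ?N = "Inl ` I \<union> Inr ` R"
  define A :: "(('i + 'i \<times> 'm \<times> 'i \<times> 'm) \<times> ('i + 'i \<times> 'm \<times> 'i \<times> 'm) \<times> bool) set" where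
    "A = (\<lambda>n. (n, n, False)) ` ?N \<union> (\<lambda>(i, x, j, y). (Inr (i, x, j, y), Inl i, False)) ` R \<union>
      (\<lambda>(i, x, j, y). (Inr (i, x, j, y), Inl j, True)) ` R"
  define J where "J = \<lparr>Obj = ?N, Arr = A, Dom = fst, Cod = fst \<circ> snd, Ide = \<lambda>n. (n, n, False),
    Comp = \<lambda>g f. if fst g = fst (snd g) then f else g\<rparr>"
  have J: "category J"
    using eqs by unfold_locales (auto simp: J_def A_def hom_def)
  define F :: "('i + 'i \<times> 'm \<times> 'i \<times> 'm,
      ('i + 'i \<times> 'm \<times> 'i \<times> 'm) \<times> ('i + 'i \<times> 'm \<times> 'i \<times> 'm) \<times> bool, 'o, 'm) func" where
    "F = \<lparr>
    on_Obj = case_sum D (\<lambda>(i, x, j, y). Dom C x),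
    on_Arr = \<lambda>(n, n', b). if n = n' then Ide C (case_sum D (\<lambda>(i, x, j, y). Dom C x) n)
      else case n of Inl i \<Rightarrow> undefined | Inr (i, x, j, y) \<Rightarrow> if b then y else x\<rparr>"
  have eqs': "i \<in> I" "j \<in> I" "x \<in> Arr C" "y \<in> Arr C" "Dom C y = Dom C x" "Cod C x = D i" "Cod C y = D j"
    "Dom C x \<in> Obj C"
    if "(i, x, j, y) \<in> R" for i x j y
    using eqs[OF that] hom_Obj by (auto simp: hom_def)
  have units: "x \<cdot> Ide C (Dom C x) = x" "Ide C (D i) \<cdot> x = x"
      "y \<cdot> Ide C (Dom C x) = y" "Ide C (D j) \<cdot> y = y"
    if "(i, x, j, y) \<in> R" for i x j y
  proof -
    have "x \<in> hom C (Dom C x) (D i)" "y \<in> hom C (Dom C x) (D j)"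
      using eqs'[OF that] by (simp_all add: hom_def)
    then show "x \<cdot> Ide C (Dom C x) = x" "Ide C (D i) \<cdot> x = x"
        "y \<cdot> Ide C (Dom C x) = y" "Ide C (D j) \<cdot> y = y"
      by (simp_all only: Comp_Ide Ide_Comp)
  qed
  have Ide: "Ide C X \<in> Arr C" "Dom C (Ide C X) = X" "Cod C (Ide C X) = X"
      "Ide C X \<cdot> Ide C X = Ide C X" if "X \<in> Obj C" for X
    using Ide_in_hom[OF that] Comp_Ide[OF Ide_in_hom[OF that]] by (auto simp: hom_def)
  have F: "is_functor J C F"
    unfolding is_functor_def J_def A_def F_def
    by (auto simp: hom_def eqs' units Ide D)
  have "small U A"
    unfolding A_def by (intro small_Un small_image U I R)
  then have "small U (Arr J)"
    by (simp add: J_def)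
  then obtain Q t where Q: "is_colimit J C F Q t"
    using colimit_small_shape[OF J _ C F] by blast
  note cocone = colimit_cocone[OF Q]
  have t: "t (Inl i) \<in> hom C (D i) Q" if "i \<in> I" for i
    using cocone(2)[of "Inl i"] that by (simp add: J_def F_def)
  have tx: "t (Inl i) \<cdot> x = t (Inr (i, x, j, y))" "t (Inl j) \<cdot> y = t (Inr (i, x, j, y))"
    if "(i, x, j, y) \<in> R" for i x j y
  proof -
    have "(Inr (i, x, j, y), Inl i, False) \<in> Arr J" "(Inr (i, x, j, y), Inl j, True) \<in> Arr J"
      using that by (simp_all add: J_def A_def image_iff Bex_def)
    from this[THEN cocone(3)] show "t (Inl i) \<cdot> x = t (Inr (i, x, j, y))"
        "t (Inl j) \<cdot> y = t (Inr (i, x, j, y))"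
      by (simp_all add: J_def F_def)
  qed
  show thesis
  proof (rule that[of "\<lambda>i. t (Inl i)" Q])
    show "t (Inl i) \<cdot> x = t (Inl j) \<cdot> y" if "(i, x, j, y) \<in> R" for i x j y
      using tx that by simp
    show "\<exists>h. h \<in> hom C Q Z \<and> (\<forall>i\<in>I. h \<cdot> t (Inl i) = s i)"
      if Z: "Z \<in> Obj C" and s: "\<And>i. i \<in> I \<Longrightarrow> s i \<in> hom C (D i) Z"
        and eq: "\<And>i x j y. (i, x, j, y) \<in> R \<Longrightarrow> s i \<cdot> x = s j \<cdot> y" for Z s
    proof -
      let ?s = "case_sum s (\<lambda>(i, x, j, y). s i \<cdot> x)"
      have sx: "s i \<cdot> x \<in> hom C (Dom C x) Z" if "(i, x, j, y) \<in> R" for i x j y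
        using Comp_in_hom[OF _ s[of i], of x "Dom C x"] eqs' that by (simp add: hom_def)
      have "is_cocone J C F Z ?s"
        unfolding is_cocone_def J_def A_def F_def
        using Z s sx eq eqs' Comp_Ide[OF s] Comp_Ide[OF sx] by auto
      then obtain h where "h \<in> hom C Q Z" "\<And>i. i \<in> Obj J \<Longrightarrow> h \<cdot> t i = ?s i"
        using colimit_desc[OF Q] by blast
      then have "h \<in> hom C Q Z \<and> (\<forall>i\<in>I. h \<cdot> t (Inl i) = s i)"
        by (simp add: J_def)
      then show ?thesis ..
    qed
    show "f = g" if f: "f \<in> hom C Q Z" and g: "g \<in> hom C Q Z"
      and eq: "\<And>i. i \<in> I \<Longrightarrow> f \<cdot> t (Inl i) = g \<cdot> t (Inl i)" for Z f g
    proof (rule colimit_eqI[OF Q J F f g])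
      fix n assume "n \<in> Obj J"
      then show "f \<cdot> t n = g \<cdot> t n"
      proof (cases n)
        case (Inl i)
        then show ?thesis using eq \<open>n \<in> Obj J\<close> by (auto simp: J_def)
      next
        case (Inr r)
        then obtain i x j y where r: "r = (i, x, j, y)" "r \<in> R"
          using \<open>n \<in> Obj J\<close> by (cases r) (auto simp: J_def)
        have x: "x \<in> hom C (Dom C x) (D i)" and i: "i \<in> I"
          using eqs'[of i x j y] r by (simp_all add: hom_def)
        have "f \<cdot> t (Inl i) \<cdot> x = g \<cdot> t (Inl i) \<cdot> x"
          using eq[OF i] by simp
        then have "f \<cdot> (t (Inl i) \<cdot> x) = g \<cdot> (t (Inl i) \<cdot> x)"
          using Comp_assoc[OF x t[OF i] f] Comp_assoc[OF x t[OF i] g] by simp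
        then show ?thesis
          using r Inr tx(1)[of i x j y] by simp
      qed
    qed
  qed (use t cocone(1) in auto)
qed
section \<open>Finiteness conditions in terms of elements\<close>

lemma poset_cat_simps [simp]:
  "Obj (poset_cat I r) = I" "Arr (poset_cat I r) = r" "Dom (poset_cat I r) = fst"
  "Cod (poset_cat I r) = snd" "Ide (poset_cat I r) i = (i, i)"
  "g \<cdot>\<^bsub>poset_cat I r\<^esub> f = (fst f, snd g)"
  by (simp_all add: poset_cat_def)

lemma set_cat_simps [simp]:
  "Obj (set_cat U) = {A. small U A}"
  "(B, g, D) \<cdot>\<^bsub>set_cat U\<^esub> (A, f, B') = (A, compose A g f, D)"
  by (simp_all add: set_cat_def)

lemma hom_set_cat:
  "f \<in> hom (set_cat U) A B \<longleftrightarrow>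
    small U A \<and> small U B \<and> (\<exists>\<phi>. \<phi> \<in> A \<rightarrow>\<^sub>E B \<and> f = (A, \<phi>, B))"
  by (auto simp: set_cat_def hom_def)

lemma hom_functor_simps [simp]:
  "on_Obj (hom_functor U C X) = hom_set U C X"
  "on_Arr (hom_functor U C X) f = (hom_set U C X (Dom C f),
    \<lambda>z\<in>hom_set U C X (Dom C f). Inr (f \<cdot>\<^bsub>C\<^esub> projr z), hom_set U C X (Cod C f))"
  by (simp_all add: hom_functor_def)

lemma functor_comp_simps [simp]:
  "on_Obj (functor_comp G F) i = on_Obj G (on_Obj F i)"
  "on_Arr (functor_comp G F) u = on_Arr G (on_Arr F u)"
  by (simp_all add: functor_comp_def)

lemma hom_set_iff: "z \<in> hom_set U C X Y \<longleftrightarrow> (\<exists>f\<in>hom C X Y. z = Inr f)"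
  by (auto simp: hom_set_def)

lemma directed_posetD:
  assumes "directed_poset I r"
  shows "i \<in> I \<Longrightarrow> (i, i) \<in> r" and "(i, j) \<in> r \<Longrightarrow> i \<in> I \<and> j \<in> I"
    and "(i, j) \<in> r \<Longrightarrow> (j, k) \<in> r \<Longrightarrow> (i, k) \<in> r"
    and "i \<in> I \<Longrightarrow> j \<in> I \<Longrightarrow> \<exists>k\<in>I. (i, k) \<in> r \<and> (j, k) \<in> r"
    and "I \<noteq> {}"
  using assms
  by (auto simp: directed_poset_def partial_order_on_def preorder_on_def
      intro: refl_onD elim: transE dest: transD)

lemma directed_diagramD:
  assumes "directed_diagram U C I r F"
  shows "small U I" and "directed_poset I r" and "is_functor (poset_cat I r) C F"
    and "category (poset_cat I r)"
  using assms category_poset_cat by (auto simp: directed_diagram_def)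

context category
begin

lemma diagram_functorD:
  assumes "directed_diagram U C I r F"
  shows "i \<in> I \<Longrightarrow> on_Obj F i \<in> Obj C"
    and "(i, j) \<in> r \<Longrightarrow> on_Arr F (i, j) \<in> hom C (on_Obj F i) (on_Obj F j)"
    and "\<lbrakk>(i, j) \<in> r; (j, k) \<in> r\<rbrakk> \<Longrightarrow> on_Arr F (j, k) \<cdot> on_Arr F (i, j) = on_Arr F (i, k)"
  using functorD[OF directed_diagramD(3)[OF assms]]
  by (fastforce+)

lemma diagram_cocone:
  assumes "is_colimit (poset_cat I r) C F Z t"
  shows "Z \<in> Obj C"
    and "i \<in> I \<Longrightarrow> t i \<in> hom C (on_Obj F i) Z"
    and "(i, j) \<in> r \<Longrightarrow> t j \<cdot> on_Arr F (i, j) = t i"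
  using colimit_cocone(1)[OF assms] colimit_cocone(2)[OF assms, of i]
    colimit_cocone(3)[OF assms, of "(i, j)"] by simp_all

lemma is_functor_functor_comp:
  assumes F: "is_functor J C F" and G: "is_functor C D G" and J: "category J"
  shows "is_functor J D (functor_comp G F)"
proof -
  interpret J: category J by fact
  show ?thesis
    unfolding is_functor_def functor_comp_simps
  proof (intro conjI ballI impI)
    fix f assume f: "f \<in> Arr J"
    note Ff = functorD(2)[OF F f]
    show "on_Arr G (on_Arr F f)
      \<in> hom D (on_Obj G (on_Obj F (Dom J f))) (on_Obj G (on_Obj F (Cod J f)))"
      using functorD(2)[OF G] hom_ArrD[OF Ff] by metis
    fix g assume g: "g \<in> Arr J" "Cod J f = Dom J g"
    note Fg = functorD(2)[OF F g(1)]
    show "on_Arr G (on_Arr F (g \<cdot>\<^bsub>J\<^esub> f)) =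
      on_Arr G (on_Arr F g) \<cdot>\<^bsub>D\<^esub> on_Arr G (on_Arr F f)"
      using functorD(4)[OF F f g] functorD(4)[OF G, of "on_Arr F f" "on_Arr F g"]
        hom_ArrD[OF Ff] hom_ArrD[OF Fg] g(2) by simp
  next
    fix i assume i: "i \<in> Obj J"
    show "on_Obj G (on_Obj F i) \<in> Obj D"
      using functorD(1)[OF F i] functorD(1)[OF G] by blast
    show "on_Arr G (on_Arr F (Ide J i)) = Ide D (on_Obj G (on_Obj F i))"
      using functorD(3)[OF F i] functorD(3)[OF G functorD(1)[OF F i]] by simp
  qed
qed

text \<open>
  A colimit in sets is covered by its injections, because otherwise two distinct functions into a
  two-element set would agree on all of them.
\<close>

lemma preserved_colimit_factor:
  fixes U :: "'u itself"
  assumes U: "universe U" "locally_small U C" and X: "X \<in> Obj C"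
    and F: "directed_diagram U C I r F" and Z: "is_colimit (poset_cat I r) C F Z t"
    and pres: "preserves_colimits_of (poset_cat I r) F C (set_cat U) (hom_functor U C X)"
    and h: "h \<in> hom C X Z"
  obtains i g where "i \<in> I" "g \<in> hom C X (on_Obj F i)" "t i \<cdot> g = h"
proof -
  have lim: "is_colimit (poset_cat I r) (set_cat U) (functor_comp (hom_functor U C X) F)
      (hom_set U C X Z) (on_Arr (hom_functor U C X) \<circ> t)"
    using pres Z by (simp add: preserves_colimits_of_def)
  have hF: "is_functor C (set_cat U) (hom_functor U C X)"
    by (rule is_functor_hom_functor[OF category_axioms U(2) X])
  interpret S: category "set_cat U :: (('u + 'm) set, _) cat"
    by (rule category_set_cat)
  note dF = directed_diagramD[OF F]
  note t = diagram_cocone[OF Z]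
  obtain a0 b0 :: 'u where "a0 \<noteq> b0"
    using universe_two_points[OF U(1)] .
  define a b :: "'u + 'm" where "a = Inl a0" and "b = Inl b0"
  have ab: "a \<noteq> b"
    using \<open>a0 \<noteq> b0\<close> by (simp add: a_def b_def)
  have small: "small U {a, b}" "small U (hom_set U C X Z)"
    using U(2) X t(1)
    by (auto simp: locally_small_def hom_set_def intro: small_image small_finite[OF U(1)])
  let ?H = "hom_set U C X"
  define im :: "'u + 'm \<Rightarrow> bool" where
    "im z \<longleftrightarrow> (\<exists>i\<in>I. \<exists>g\<in>hom C X (on_Obj F i). z = Inr (t i \<cdot> g))" for z
  have im: "im (Inr (t i \<cdot> g))" if "i \<in> I" "g \<in> hom C X (on_Obj F i)" for i g
    using that unfolding im_def by blast
  have arr: "(?H Z, \<lambda>z\<in>?H Z. c z, {a, b}) \<in> hom (set_cat U) (?H Z) {a, b}"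
    if "\<And>z. c z \<in> {a, b}" for c
    unfolding hom_set_cat using small that
    by (intro conjI exI[of _ "restrict c (?H Z)"] PiE_I) simp_all
  have "(?H Z, \<lambda>z\<in>?H Z. a, {a, b}) = (?H Z, \<lambda>z\<in>?H Z. if im z then a else b, {a, b})"
  proof (rule S.colimit_eqI[OF lim dF(4) is_functor_functor_comp[OF dF(3) hF dF(4)]])
    fix i assume "i \<in> Obj (poset_cat I r)"
    then have i: "i \<in> I" by simp
    have ti: "Dom C (t i) = on_Obj F i" "Cod C (t i) = Z"
      using t(2)[OF i] by (auto simp: hom_def)
    show "(?H Z, \<lambda>z\<in>?H Z. a, {a, b}) \<cdot>\<^bsub>set_cat U\<^esub> (on_Arr (hom_functor U C X) \<circ> t) i =
      (?H Z, \<lambda>z\<in>?H Z. if im z then a else b, {a, b}) \<cdot>\<^bsub>set_cat U\<^esub> (on_Arr (hom_functor U C X) \<circ> t) i"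
      using i Comp_in_hom[OF _ t(2)[OF i]] im[OF i]
      by (auto simp: ti compose_def hom_set_iff fun_eq_iff)
  qed (rule arr, simp)+
  then have "(\<lambda>z\<in>?H Z. a) (Inr h) = (\<lambda>z\<in>?H Z. if im z then a else b) (Inr h)"
    by simp
  then have "im (Inr h)"
    using h ab by (auto simp: hom_set_iff split: if_splits)
  then show thesis
    using that unfolding im_def by auto
qed

text \<open>
  The elements of a directed diagram of sets that become equal to a given \<open>x\<close> at some later stage
  are the preimage of a point under a cocone into a two-element set; this cocone factors through
  the colimit.
\<close>

lemma preserved_colimit_eq:
  fixes U :: "'u itself"
  assumes U: "universe U" "locally_small U C" and X: "X \<in> Obj C"
    and F: "directed_diagram U C I r F" and Z: "is_colimit (poset_cat I r) C F Z t"
    and pres: "preserves_colimits_of (poset_cat I r) F C (set_cat U) (hom_functor U C X)"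
    and i: "i \<in> I" and x: "x \<in> hom C X (on_Obj F i)" and y: "y \<in> hom C X (on_Obj F i)"
    and eq: "t i \<cdot> x = t i \<cdot> y"
  obtains k where "(i, k) \<in> r" "on_Arr F (i, k) \<cdot> x = on_Arr F (i, k) \<cdot> y"
proof -
  have lim: "is_colimit (poset_cat I r) (set_cat U) (functor_comp (hom_functor U C X) F)
      (hom_set U C X Z) (on_Arr (hom_functor U C X) \<circ> t)"
    using pres Z by (simp add: preserves_colimits_of_def)
  note dF = directed_diagramD[OF F]
  note dr = directed_posetD[OF dF(2)]
  note fF = diagram_functorD[OF F]
  note t = diagram_cocone[OF Z]
  obtain a0 b0 :: 'u where "a0 \<noteq> b0"
    using universe_two_points[OF U(1)] .
  define a b :: "'u + 'm" where "a = Inl a0" and "b = Inl b0"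
  have ab: "a \<noteq> b"
    using \<open>a0 \<noteq> b0\<close> by (simp add: a_def b_def)
  have small: "small U {a, b}" "small U (hom_set U C X Y)" if "Y \<in> Obj C" for Y
    using U(2) X that
    by (auto simp: locally_small_def hom_set_def intro: small_image small_finite[OF U(1)])
  let ?H = "hom_set U C X"
  define meets where "meets j z \<longleftrightarrow>
    (\<exists>l. (i, l) \<in> r \<and> (j, l) \<in> r \<and> on_Arr F (j, l) \<cdot> z = on_Arr F (i, l) \<cdot> x)" for j z
  have meets: "meets k (on_Arr F (j, k) \<cdot> z) \<longleftrightarrow> meets j z"
    if jk: "(j, k) \<in> r" and z: "z \<in> hom C X (on_Obj F j)" for j k z
  proof
    have F_jkl: "on_Arr F (k, l) \<cdot> (on_Arr F (j, k) \<cdot> z) = on_Arr F (j, l) \<cdot> z"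
      if "(k, l) \<in> r" for l
      using Comp_eq_assoc[OF fF(3)[OF jk that] fF(2)[OF jk] fF(2)[OF that] z] .
    {
      assume "meets k (on_Arr F (j, k) \<cdot> z)"
      then show "meets j z"
        unfolding meets_def using F_jkl dr(3)[OF jk] by metis
    next
      assume "meets j z"
      then obtain l where l: "(i, l) \<in> r" "(j, l) \<in> r"
        "on_Arr F (j, l) \<cdot> z = on_Arr F (i, l) \<cdot> x"
        unfolding meets_def by blast
      obtain n where n: "(l, n) \<in> r" "(k, n) \<in> r"
        using dr(4)[of l k] dr(2)[OF l(1)] dr(2)[OF jk] by blast
      have "on_Arr F (k, n) \<cdot> (on_Arr F (j, k) \<cdot> z) = on_Arr F (l, n) \<cdot> (on_Arr F (j, l) \<cdot> z)"
        using F_jkl[OF n(2)] Comp_eq_assoc[OF fF(3)[OF l(2) n(1)] fF(2)[OF l(2)] fF(2)[OF n(1)] z]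
        by simp
      also have "\<dots> = on_Arr F (i, n) \<cdot> x"
        unfolding l(3)
        using Comp_eq_assoc[OF fF(3)[OF l(1) n(1)] fF(2)[OF l(1)] fF(2)[OF n(1)] x] .
      finally show "meets k (on_Arr F (j, k) \<cdot> z)"
        unfolding meets_def using n(2) dr(3)[OF l(1) n(1)] by blast
    }
  qed
  define s where "s j = (?H (on_Obj F j),
    \<lambda>z\<in>?H (on_Obj F j). if meets j (projr z) then a else b, {a, b})" for j
  have "is_cocone (poset_cat I r) (set_cat U) (functor_comp (hom_functor U C X) F) {a, b} s"
    unfolding is_cocone_def
  proof (intro conjI ballI)
    fix u assume "u \<in> Arr (poset_cat I r)"
    then obtain j k where u: "u = (j, k)" "(j, k) \<in> r"
      by (cases u) auto
    note Fu = fF(2)[OF u(2)]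
    show "s (Cod (poset_cat I r) u) \<cdot>\<^bsub>set_cat U\<^esub> on_Arr (functor_comp (hom_functor U C X) F) u
      = s (Dom (poset_cat I r) u)"
      using hom_ArrD[OF Fu] Comp_in_hom[OF _ Fu] meets[OF u(2)]
      by (auto simp: u s_def compose_def hom_set_iff fun_eq_iff)
  qed (use small fF(1) t(1) in \<open>auto simp: s_def hom_set_cat\<close>)
  then obtain g where "\<And>j. j \<in> I \<Longrightarrow> g \<cdot>\<^bsub>set_cat U\<^esub> on_Arr (hom_functor U C X) (t j) = s j"
      and g: "g \<in> hom (set_cat U) (?H Z) {a, b}"
    using colimit_desc[OF lim] by (metis comp_apply poset_cat_simps(1))
  then have gi: "g \<cdot>\<^bsub>set_cat U\<^esub> on_Arr (hom_functor U C X) (t i) = s i"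
    using i by blast
  obtain \<phi> where \<phi>: "g = (?H Z, \<phi>, {a, b})"
    using g by (auto simp: hom_set_cat)
  have app: "\<phi> (Inr (t i \<cdot> w)) = (if meets i w then a else b)" if "w \<in> hom C X (on_Obj F i)" for w
  proof -
    have "compose (?H (on_Obj F i)) \<phi> (\<lambda>z\<in>?H (on_Obj F i). Inr (t i \<cdot> projr z)) (Inr w)
      = (\<lambda>z\<in>?H (on_Obj F i). if meets i (projr z) then a else b) (Inr w)"
      using gi hom_ArrD[OF t(2)[OF i]] by (simp add: \<phi> s_def)
    then show ?thesis
      using that by (simp add: compose_def hom_set_iff)
  qed
  have "meets i x"
    unfolding meets_def using dr(1)[OF i] by blast
  then have "meets i y"
    using app[OF x] app[OF y] eq ab by (simp split: if_splits)
  then show thesis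
    using that unfolding meets_def by metis
qed

text \<open>
  A jointly surjective cocone of injective maps over a directed diagram of sets is a colimit: two
  representatives of the same element can be compared at a common later stage, and coincide there,
  so functions out of the stages glue to a well-defined function.
\<close>

lemma preserves_colimitI:
  fixes U :: "'u itself"
  assumes U: "universe U" "locally_small U C" and X: "X \<in> Obj C"
    and F: "directed_diagram U C I r F"
    and mono: "\<And>Z t i. is_colimit (poset_cat I r) C F Z t \<Longrightarrow> i \<in> I \<Longrightarrow> monomorphism C (t i)"
    and factor: "\<And>Z t h. is_colimit (poset_cat I r) C F Z t \<Longrightarrow> h \<in> hom C X Z \<Longrightarrow>
      \<exists>i\<in>I. \<exists>g\<in>hom C X (on_Obj F i). t i \<cdot> g = h"
  shows "preserves_colimits_of (poset_cat I r) F C (set_cat U) (hom_functor U C X)"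
  unfolding preserves_colimits_of_def
proof (intro allI impI)
  fix Z t assume Z: "is_colimit (poset_cat I r) C F Z t"
  note dF = directed_diagramD[OF F]
  note dr = directed_posetD[OF dF(2)]
  note fF = diagram_functorD[OF F]
  note t = diagram_cocone[OF Z]
  let ?H = "hom_set U C X"
  let ?F = "functor_comp (hom_functor U C X) F"
  let ?t = "on_Arr (hom_functor U C X) \<circ> t"
  have hF: "is_functor C (set_cat U) (hom_functor U C X)"
    by (rule is_functor_hom_functor[OF category_axioms U(2) X])
  have tArr: "t i \<in> Arr C" "Dom C (t i) = on_Obj F i" "Cod C (t i) = Z" if "i \<in> I" for i
    using hom_ArrD[OF t(2)[OF that]] by auto
  have small: "small U (?H Y)" if "Y \<in> Obj C" for Y
    using functorD(1)[OF hF that] by simp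
  have "is_cocone (poset_cat I r) (set_cat U) ?F (?H Z) ?t"
    unfolding is_cocone_def
  proof (intro conjI ballI)
    fix i assume "i \<in> Obj (poset_cat I r)"
    then have i: "i \<in> I" by simp
    show "?t i \<in> hom (set_cat U) (on_Obj ?F i) (?H Z)"
      using functorD(2)[OF hF tArr(1)[OF i]] unfolding tArr(2,3)[OF i] by simp
  next
    fix u assume "u \<in> Arr (poset_cat I r)"
    then obtain j k where u: "u = (j, k)" "(j, k) \<in> r"
      by (cases u) auto
    have I: "j \<in> I" "k \<in> I"
      using dr(2)[OF u(2)] by auto
    show "?t (Cod (poset_cat I r) u) \<cdot>\<^bsub>set_cat U\<^esub> on_Arr ?F u = ?t (Dom (poset_cat I r) u)"
      using functorD(4)[OF hF, of "on_Arr F u" "t k"] hom_ArrD[OF fF(2)[OF u(2)]] tArr I t(3)[OF u(2)]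
      by (simp add: u del: hom_functor_simps(2))
  qed (use small t(1) in auto)
  moreover have "\<exists>!h. h \<in> hom (set_cat U) (?H Z) Y \<and> (\<forall>i\<in>I. h \<cdot>\<^bsub>set_cat U\<^esub> ?t i = s i)"
    if s: "is_cocone (poset_cat I r) (set_cat U) ?F Y s" for Y s
  proof -
    have "\<exists>\<psi>. \<psi> \<in> ?H (on_Obj F i) \<rightarrow>\<^sub>E Y \<and> s i = (?H (on_Obj F i), \<psi>, Y)" if "i \<in> I" for i
      using s that by (simp add: is_cocone_def hom_set_cat)
    then obtain \<sigma> where \<sigma>: "\<And>i. i \<in> I \<Longrightarrow> \<sigma> i \<in> ?H (on_Obj F i) \<rightarrow>\<^sub>E Y"
        and s_eq: "\<And>i. i \<in> I \<Longrightarrow> s i = (?H (on_Obj F i), \<sigma> i, Y)"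
      by metis
    have \<sigma>_trans: "\<sigma> k (Inr (on_Arr F (j, k) \<cdot> z)) = \<sigma> j (Inr z)"
      if jk: "(j, k) \<in> r" and z: "z \<in> hom C X (on_Obj F j)" for j k z
    proof -
      have I: "j \<in> I" "k \<in> I"
        using dr(2)[OF jk] by auto
      have "s k \<cdot>\<^bsub>set_cat U\<^esub> on_Arr ?F (j, k) = s j"
        using s jk unfolding is_cocone_def by fastforce
      then have "compose (?H (on_Obj F j)) (\<sigma> k) (\<lambda>z\<in>?H (on_Obj F j). Inr (on_Arr F (j, k) \<cdot> projr z))
          (Inr z) = \<sigma> j (Inr z)"
        using hom_ArrD[OF fF(2)[OF jk]] by (simp add: s_eq I)
      then show ?thesis
        using z by (simp add: compose_def hom_set_iff)
    qed
    have wd: "\<sigma> i (Inr g) = \<sigma> j (Inr g')"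
      if i: "i \<in> I" and j: "j \<in> I" and g: "g \<in> hom C X (on_Obj F i)"
        and g': "g' \<in> hom C X (on_Obj F j)" and eq: "t i \<cdot> g = t j \<cdot> g'" for i j g g'
    proof -
      obtain k where k: "k \<in> I" "(i, k) \<in> r" "(j, k) \<in> r"
        using dr(4)[OF i j] by blast
      have "t k \<cdot> (on_Arr F (i, k) \<cdot> g) = t k \<cdot> (on_Arr F (j, k) \<cdot> g')"
        using Comp_eq_assoc[OF t(3)[OF k(2)] fF(2)[OF k(2)] t(2)[OF k(1)] g] eq
          Comp_eq_assoc[OF t(3)[OF k(3)] fF(2)[OF k(3)] t(2)[OF k(1)] g'] by simp
      then have "on_Arr F (i, k) \<cdot> g = on_Arr F (j, k) \<cdot> g'"
        by (rule monoD[OF mono[OF Z k(1)] t(2)[OF k(1)]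
              Comp_in_hom[OF g fF(2)[OF k(2)]] Comp_in_hom[OF g' fF(2)[OF k(3)]]])
      then show ?thesis
        using \<sigma>_trans[OF k(2) g] \<sigma>_trans[OF k(3) g'] by simp
    qed
    have "\<exists>\<phi>. \<forall>i\<in>I. \<forall>g\<in>hom C X (on_Obj F i). \<phi> (t i \<cdot> g) = \<sigma> i (Inr g)"
    proof
      let ?\<phi> = "\<lambda>z. SOME y. \<exists>i\<in>I. \<exists>g\<in>hom C X (on_Obj F i). t i \<cdot> g = z \<and> y = \<sigma> i (Inr g)"
      show "\<forall>i\<in>I. \<forall>g\<in>hom C X (on_Obj F i). ?\<phi> (t i \<cdot> g) = \<sigma> i (Inr g)"
      proof (intro ballI)
        fix i g assume i: "i \<in> I" and g: "g \<in> hom C X (on_Obj F i)"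
        show "?\<phi> (t i \<cdot> g) = \<sigma> i (Inr g)"
        proof (rule some_equality)
          show "\<exists>i'\<in>I. \<exists>g'\<in>hom C X (on_Obj F i'). t i' \<cdot> g' = t i \<cdot> g \<and> \<sigma> i (Inr g) = \<sigma> i' (Inr g')"
            using i g by blast
          show "y = \<sigma> i (Inr g)"
            if "\<exists>i'\<in>I. \<exists>g'\<in>hom C X (on_Obj F i'). t i' \<cdot> g' = t i \<cdot> g \<and> y = \<sigma> i' (Inr g')" for y
            using that wd i g by blast
        qed
      qed
    qed
    then obtain \<phi> where \<phi>: "\<And>i g. i \<in> I \<Longrightarrow> g \<in> hom C X (on_Obj F i) \<Longrightarrow>
        \<phi> (t i \<cdot> g) = \<sigma> i (Inr g)"
      by blast
    define \<phi>' where "\<phi>' = (\<lambda>z\<in>?H Z. \<phi> (projr z))"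
    have \<phi>'_fun: "\<phi>' \<in> ?H Z \<rightarrow>\<^sub>E Y"
    proof (rule PiE_I)
      fix z assume "z \<in> ?H Z"
      then obtain h where h: "h \<in> hom C X Z" "z = Inr h"
        by (auto simp: hom_set_iff)
      obtain i g where ig: "i \<in> I" "g \<in> hom C X (on_Obj F i)" "t i \<cdot> g = h"
        using factor[OF Z h(1)] by blast
      have "\<phi>' z = \<sigma> i (Inr g)"
        using h \<phi>[OF ig(1,2)] by (auto simp: \<phi>'_def hom_set_iff ig(3))
      then show "\<phi>' z \<in> Y"
        using \<sigma>[OF ig(1)] ig(2) by (auto simp: hom_set_iff)
    qed (simp add: \<phi>'_def)
    show ?thesis
    proof (rule ex1I[of _ "(?H Z, \<phi>', Y)"], intro conjI ballI)
      show "(?H Z, \<phi>', Y) \<in> hom (set_cat U) (?H Z) Y"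
        using \<phi>'_fun small t(1) s by (auto simp: hom_set_cat is_cocone_def)
      fix i assume i: "i \<in> I"
      have "compose (?H (on_Obj F i)) \<phi>' (\<lambda>z\<in>?H (on_Obj F i). Inr (t i \<cdot> projr z)) = \<sigma> i"
      proof
        fix z show "compose (?H (on_Obj F i)) \<phi>' (\<lambda>z\<in>?H (on_Obj F i). Inr (t i \<cdot> projr z)) z = \<sigma> i z"
        proof (cases "z \<in> ?H (on_Obj F i)")
          case True
          then obtain g where g: "g \<in> hom C X (on_Obj F i)" "z = Inr g"
            by (auto simp: hom_set_iff)
          have "Inr (t i \<cdot> g) \<in> ?H Z"
            using Comp_in_hom[OF g(1) t(2)[OF i]] by (simp add: hom_set_iff)
          then show ?thesis
            using True g(2) \<phi>[OF i g(1)] by (simp add: compose_def \<phi>'_def)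
        next
          case False
          then show ?thesis
            using PiE_arb[OF \<sigma>[OF i] False] by (simp add: compose_def)
        qed
      qed
      then show "(?H Z, \<phi>', Y) \<cdot>\<^bsub>set_cat U\<^esub> ?t i = s i"
        by (simp add: s_eq tArr i)
    next
      fix h assume h: "h \<in> hom (set_cat U) (?H Z) Y \<and> (\<forall>i\<in>I. h \<cdot>\<^bsub>set_cat U\<^esub> ?t i = s i)"
      then obtain \<psi> where \<psi>: "\<psi> \<in> ?H Z \<rightarrow>\<^sub>E Y" "h = (?H Z, \<psi>, Y)"
        by (auto simp: hom_set_cat)
      have "\<psi> z = \<phi>' z" for z
      proof (cases "z \<in> ?H Z")
        case True
        then obtain w where w: "w \<in> hom C X Z" "z = Inr w"
          by (auto simp: hom_set_iff)
        obtain i g where ig: "i \<in> I" "g \<in> hom C X (on_Obj F i)" "t i \<cdot> g = w"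
          using factor[OF Z w(1)] by blast
        have "h \<cdot>\<^bsub>set_cat U\<^esub> ?t i = s i"
          using h ig(1) by blast
        then have "compose (?H (on_Obj F i)) \<psi> (\<lambda>z\<in>?H (on_Obj F i). Inr (t i \<cdot> projr z)) (Inr g)
            = \<sigma> i (Inr g)"
          by (simp add: \<psi>(2) s_eq tArr ig(1))
        then have "\<psi> z = \<sigma> i (Inr g)"
          using ig w by (simp add: compose_def hom_set_iff)
        then show ?thesis
          using w \<phi>[OF ig(1,2)] by (auto simp: \<phi>'_def hom_set_iff ig(3))
      next
        case False
        then show ?thesis
          using PiE_arb[OF \<psi>(1) False] PiE_arb[OF \<phi>'_fun False] by simp
      qed
      then show "h = (?H Z, \<phi>', Y)"
        using \<psi>(2) by auto
    qed
  qed
  ultimately show "is_colimit (poset_cat I r) (set_cat U) ?F (on_Obj (hom_functor U C X) Z) ?t"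
    by (simp add: is_colimit_def)
qed

end

section \<open>Locally finitely presentable categories\<close>

definition cokernel_pair :: "('o, 'm) cat \<Rightarrow> 'm \<Rightarrow> 'o \<Rightarrow> 'm \<Rightarrow> 'm \<Rightarrow> bool" where
  "cokernel_pair C m P p q \<longleftrightarrow>
     m \<in> Arr C \<and> p \<in> hom C (Cod C m) P \<and> q \<in> hom C (Cod C m) P \<and> p \<cdot>\<^bsub>C\<^esub> m = q \<cdot>\<^bsub>C\<^esub> m \<and>
     (\<forall>Z. \<forall>f\<in>hom C (Cod C m) Z. \<forall>g\<in>hom C (Cod C m) Z. f \<cdot>\<^bsub>C\<^esub> m = g \<cdot>\<^bsub>C\<^esub> m \<longrightarrow>
        (\<exists>!h. h \<in> hom C P Z \<and> h \<cdot>\<^bsub>C\<^esub> p = f \<and> h \<cdot>\<^bsub>C\<^esub> q = g))"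

definition strong_epi :: "('o, 'm) cat \<Rightarrow> 'm \<Rightarrow> bool" where
  "strong_epi C e \<longleftrightarrow>
     epimorphism C e \<and>
     (\<forall>n u v. monomorphism C n \<longrightarrow> u \<in> hom C (Dom C e) (Dom C n) \<longrightarrow> v \<in> hom C (Cod C e) (Cod C n) \<longrightarrow>
        n \<cdot>\<^bsub>C\<^esub> u = v \<cdot>\<^bsub>C\<^esub> e \<longrightarrow> (\<exists>d\<in>hom C (Cod C e) (Dom C n). d \<cdot>\<^bsub>C\<^esub> e = u \<and> n \<cdot>\<^bsub>C\<^esub> d = v))"

context category
begin

lemma cokernel_pairD:
  assumes "cokernel_pair C m P p q" and m: "m \<in> hom C A B"
  shows "p \<in> hom C B P" and "q \<in> hom C B P" and "p \<cdot> m = q \<cdot> m"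
    and "\<lbrakk>f \<in> hom C B Z; g \<in> hom C B Z; f \<cdot> m = g \<cdot> m\<rbrakk> \<Longrightarrow> \<exists>h\<in>hom C P Z. h \<cdot> p = f \<and> h \<cdot> q = g"
  using assms(1) hom_ArrD[OF m] unfolding cokernel_pair_def by blast+

lemma cokernel_pair_eqI:
  assumes P: "cokernel_pair C m P p q" and m: "m \<in> hom C A B"
    and f: "f \<in> hom C P Z" and g: "g \<in> hom C P Z" and eq: "f \<cdot> p = g \<cdot> p" "f \<cdot> q = g \<cdot> q"
  shows "f = g"
proof -
  note p = cokernel_pairD(1)[OF P m] and q = cokernel_pairD(2)[OF P m]
  have "f \<cdot> p \<cdot> m = f \<cdot> q \<cdot> m"
    using Comp_assoc[OF m p f] Comp_assoc[OF m q f] cokernel_pairD(3)[OF P m] by simp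
  then have "\<exists>!h. h \<in> hom C P Z \<and> h \<cdot> p = f \<cdot> p \<and> h \<cdot> q = f \<cdot> q"
    using P Comp_in_hom[OF p f] Comp_in_hom[OF q f] hom_ArrD[OF m]
    unfolding cokernel_pair_def by simp
  then show ?thesis
    using f g eq by (metis (no_types, lifting))
qed

lemma strong_epi_hom:
  assumes "strong_epi C e" "e \<in> hom C X Y"
  shows "epimorphism C e"
    and "\<lbrakk>monomorphism C n; n \<in> hom C M N; u \<in> hom C X M; v \<in> hom C Y N; n \<cdot> u = v \<cdot> e\<rbrakk> \<Longrightarrow>
      \<exists>d\<in>hom C Y M. d \<cdot> e = u \<and> n \<cdot> d = v"
  using assms(1) hom_ArrD[OF assms(2)] hom_ArrD[of n C M N] unfolding strong_epi_def by blast+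

text \<open>The lower triangle of the lifting condition is automatic for an epimorphism.\<close>

lemma strong_epiI:
  assumes e: "e \<in> hom C X Y" and epi: "epimorphism C e"
    and lift: "\<And>n M N u v. \<lbrakk>monomorphism C n; n \<in> hom C M N; u \<in> hom C X M; v \<in> hom C Y N;
      n \<cdot> u = v \<cdot> e\<rbrakk> \<Longrightarrow> \<exists>d\<in>hom C Y M. d \<cdot> e = u"
  shows "strong_epi C e"
  unfolding strong_epi_def
proof (intro conjI allI impI)
  fix n u v
  assume n: "monomorphism C n" and "u \<in> hom C (Dom C e) (Dom C n)"
    and "v \<in> hom C (Cod C e) (Cod C n)" and eq: "n \<cdot> u = v \<cdot> e"
  then have u: "u \<in> hom C X (Dom C n)" and v: "v \<in> hom C Y (Cod C n)"
    using hom_ArrD[OF e] by simp_all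
  have nh: "n \<in> hom C (Dom C n) (Cod C n)"
    using n by (simp add: monomorphism_def hom_def)
  obtain d where d: "d \<in> hom C Y (Dom C n)" "d \<cdot> e = u"
    using lift[OF n nh u v eq] by blast
  have "n \<cdot> d \<cdot> e = v \<cdot> e"
    using Comp_assoc[OF e d(1) nh] d(2) eq by simp
  then have "n \<cdot> d = v"
    by (rule epiD[OF epi e Comp_in_hom[OF d(1) nh] v])
  then show "\<exists>d\<in>hom C (Cod C e) (Dom C n). d \<cdot> e = u \<and> n \<cdot> d = v"
    using d hom_ArrD[OF e] by auto
qed (rule epi)

lemma epi_Comp:
  assumes e: "epimorphism C e" "e \<in> hom C X Y" and f: "epimorphism C f" "f \<in> hom C Y Z"
  shows "epimorphism C (f \<cdot> e)"
proof (rule epiI[OF Comp_in_hom[OF e(2) f(2)]])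
  fix W u v assume u: "u \<in> hom C Z W" and v: "v \<in> hom C Z W" and eq: "u \<cdot> (f \<cdot> e) = v \<cdot> (f \<cdot> e)"
  have "u \<cdot> f \<cdot> e = v \<cdot> f \<cdot> e"
    using eq Comp_assoc[OF e(2) f(2) u] Comp_assoc[OF e(2) f(2) v] by simp
  then have "u \<cdot> f = v \<cdot> f"
    by (rule epiD[OF e Comp_in_hom[OF f(2) u] Comp_in_hom[OF f(2) v]])
  then show "u = v"
    by (rule epiD[OF f u v])
qed

lemma strong_epi_Comp:
  assumes e: "strong_epi C e" "e \<in> hom C X Y" and f: "strong_epi C f" "f \<in> hom C Y Z"
  shows "strong_epi C (f \<cdot> e)"
proof (rule strong_epiI[OF Comp_in_hom[OF e(2) f(2)]])
  show "epimorphism C (f \<cdot> e)"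
    using epi_Comp[OF strong_epi_hom(1)[OF e] e(2) strong_epi_hom(1)[OF f] f(2)] .
  fix n M N u v
  assume n: "monomorphism C n" "n \<in> hom C M N" and u: "u \<in> hom C X M" and v: "v \<in> hom C Z N"
    and eq: "n \<cdot> u = v \<cdot> (f \<cdot> e)"
  have "n \<cdot> u = v \<cdot> f \<cdot> e"
    using eq Comp_assoc[OF e(2) f(2) v] by simp
  then obtain d where d: "d \<in> hom C Y M" "d \<cdot> e = u" "n \<cdot> d = v \<cdot> f"
    using strong_epi_hom(2)[OF e n u Comp_in_hom[OF f(2) v]] by blast
  obtain d' where d': "d' \<in> hom C Z M" "d' \<cdot> f = d"
    using strong_epi_hom(2)[OF f n d(1) v d(3)] by blast
  show "\<exists>d\<in>hom C Z M. d \<cdot> (f \<cdot> e) = u"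
    using Comp_assoc[OF e(2) f(2) d'(1)] d(2) d' by auto
qed

lemma strong_epi_Ide: "X \<in> Obj C \<Longrightarrow> strong_epi C (Ide C X)"
proof (rule strong_epiI[OF Ide_in_hom])
  assume X: "X \<in> Obj C"
  show "epimorphism C (Ide C X)"
    by (rule epiI[OF Ide_in_hom[OF X]]) (simp only: Comp_Ide)
  fix M N n u v assume u: "u \<in> hom C X M"
  then show "\<exists>d\<in>hom C X M. d \<cdot> Ide C X = u"
    using Comp_Ide[OF u] by blast
qed

end

locale lfp_category = category C for C :: "('o, 'm) cat" (structure) +
  fixes U :: "'u itself" and G :: "'o set"
  assumes universe: "universe U"
    and locally_small: "locally_small U C"
    and cocomplete: "cocomplete U C"
    and small_G: "small U G"
    and G_presentable: "g \<in> G \<Longrightarrow> finitely_presentable U C g"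
    and G_directed_colimit: "X \<in> Obj C \<Longrightarrow> \<exists>I r F t. directed_diagram U C I r F \<and>
      (\<forall>i\<in>I. on_Obj F i \<in> G) \<and> is_colimit (poset_cat I r) C F X t"
begin

lemma small_hom: "\<lbrakk>X \<in> Obj C; Y \<in> Obj C\<rbrakk> \<Longrightarrow> small U (hom C X Y)"
  using locally_small by (simp add: locally_small_def)

lemma G_Obj: "g \<in> G \<Longrightarrow> g \<in> Obj C"
  using G_presentable by (simp add: finitely_presentable_def)

lemma G_factor:
  assumes g: "g \<in> G" and F: "directed_diagram U C I r F"
    and Z: "is_colimit (poset_cat I r) C F Z t" and h: "h \<in> hom C g Z"
  obtains i x where "i \<in> I" "x \<in> hom C g (on_Obj F i)" "t i \<cdot> x = h"
  using preserved_colimit_factor[OF universe locally_small G_Obj[OF g] F Z _ h]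
    G_presentable[OF g] F unfolding finitely_presentable_def by blast

lemma G_eq:
  assumes g: "g \<in> G" and F: "directed_diagram U C I r F"
    and Z: "is_colimit (poset_cat I r) C F Z t" and i: "i \<in> I"
    and x: "x \<in> hom C g (on_Obj F i)" and y: "y \<in> hom C g (on_Obj F i)"
    and eq: "t i \<cdot> x = t i \<cdot> y"
  obtains k where "(i, k) \<in> r" "on_Arr F (i, k) \<cdot> x = on_Arr F (i, k) \<cdot> y"
  using preserved_colimit_eq[OF universe locally_small G_Obj[OF g] F Z _ i x y eq]
    G_presentable[OF g] F unfolding finitely_presentable_def by blast

lemma G_jointly_epi:
  assumes f: "f \<in> hom C X Y" and f': "f' \<in> hom C X Y"
    and eq: "\<And>g x. \<lbrakk>g \<in> G; x \<in> hom C g X\<rbrakk> \<Longrightarrow> f \<cdot> x = f' \<cdot> x"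
  shows "f = f'"
proof -
  obtain I r F t where F: "directed_diagram U C I r F" and FG: "\<And>i. i \<in> I \<Longrightarrow> on_Obj F i \<in> G"
    and X: "is_colimit (poset_cat I r) C F X t"
    using G_directed_colimit[OF hom_Obj(1)[OF f]] by blast
  show ?thesis
    by (rule colimit_eqI[OF X directed_diagramD(4,3)[OF F] f f'])
      (use eq[OF FG diagram_cocone(2)[OF X]] in simp)
qed

lemma mono_on_GI:
  assumes m: "m \<in> hom C X Y"
    and inj: "\<And>g x y. \<lbrakk>g \<in> G; x \<in> hom C g X; y \<in> hom C g X; m \<cdot> x = m \<cdot> y\<rbrakk> \<Longrightarrow> x = y"
  shows "monomorphism C m"
proof (rule monoI[OF m])
  fix W f f' assume f: "f \<in> hom C W X" and f': "f' \<in> hom C W X" and eq: "m \<cdot> f = m \<cdot> f'"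
  show "f = f'"
  proof (rule G_jointly_epi[OF f f'])
    fix g x assume g: "g \<in> G" and x: "x \<in> hom C g W"
    show "f \<cdot> x = f' \<cdot> x"
      using inj[OF g Comp_in_hom[OF x f] Comp_in_hom[OF x f']]
        Comp_assoc[OF x f m] Comp_assoc[OF x f' m] eq by simp
  qed
qed

text \<open>
  Two arrows from a generator that become equal in the colimit are already equal at a later stage,
  and the connecting arrow to that stage is a monomorphism.
\<close>

lemma mono_colimit_injection:
  assumes F: "directed_diagram U C I r F" and mono: "\<forall>u\<in>r. monomorphism C (on_Arr F u)"
    and Z: "is_colimit (poset_cat I r) C F Z t" and i: "i \<in> I"
  shows "monomorphism C (t i)"
proof (rule mono_on_GI[OF diagram_cocone(2)[OF Z i]])
  fix g x y
  assume g: "g \<in> G" and x: "x \<in> hom C g (on_Obj F i)" and y: "y \<in> hom C g (on_Obj F i)"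
    and eq: "t i \<cdot> x = t i \<cdot> y"
  obtain k where k: "(i, k) \<in> r" "on_Arr F (i, k) \<cdot> x = on_Arr F (i, k) \<cdot> y"
    using G_eq[OF g F Z i x y eq] .
  then show "x = y"
    using monoD[OF _ diagram_functorD(2)[OF F k(1)] x y] mono by blast
qed

text \<open>
  Since the injections of such colimits are monomorphisms, two factorisations through a common
  stage always coincide; only their existence is at stake.
\<close>

lemma finitely_generatedI:
  assumes X: "X \<in> Obj C"
    and factor: "\<And>I r F Z t h. \<lbrakk>directed_diagram U C I r F; \<forall>u\<in>r. monomorphism C (on_Arr F u);
      is_colimit (poset_cat I r) C F Z t; h \<in> hom C X Z\<rbrakk> \<Longrightarrow>
      \<exists>i\<in>I. \<exists>g\<in>hom C X (on_Obj F i). t i \<cdot> g = h"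
  shows "finitely_generated U C X"
  unfolding finitely_generated_def
proof (intro conjI allI impI X)
  fix I r F
  assume F: "directed_diagram U C I r F" and mono: "\<forall>u\<in>r. monomorphism C (on_Arr F u)"
  show "preserves_colimits_of (poset_cat I r) F C (set_cat U) (hom_functor U C X)"
    by (rule preserves_colimitI[OF universe locally_small X F])
      (fact mono_colimit_injection[OF F mono], fact factor[OF F mono])
qed

lemma finitely_generated_factor:
  assumes X: "finitely_generated U C X"
    and F: "directed_diagram U C I r F" and mono: "\<forall>u\<in>r. monomorphism C (on_Arr F u)"
    and Z: "is_colimit (poset_cat I r) C F Z t" and h: "h \<in> hom C X Z"
  obtains i g where "i \<in> I" "g \<in> hom C X (on_Obj F i)" "t i \<cdot> g = h"
  using preserved_colimit_factor[OF universe locally_small _ F Z _ h] X F mono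
  unfolding finitely_generated_def by blast

lemma G_finitely_generated: "g \<in> G \<Longrightarrow> finitely_generated U C g"
  using G_presentable by (simp add: finitely_presentable_def finitely_generated_def)

lemma coproduct:
  assumes "X \<in> Obj C" "Y \<in> Obj C"
  obtains S i j where "i \<in> hom C X S" "j \<in> hom C Y S"
    and "\<And>Z f g. \<lbrakk>f \<in> hom C X Z; g \<in> hom C Y Z\<rbrakk> \<Longrightarrow> \<exists>h\<in>hom C S Z. h \<cdot> i = f \<and> h \<cdot> j = g"
    and "\<And>Z f g. \<lbrakk>f \<in> hom C S Z; g \<in> hom C S Z; f \<cdot> i = g \<cdot> i; f \<cdot> j = g \<cdot> j\<rbrakk> \<Longrightarrow> f = g"
proof -
  have fin: "small U (UNIV :: bool set)" "small U ({} :: (bool \<times> 'm \<times> bool \<times> 'm) set)"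
    by (simp_all add: small_finite[OF universe])
  have Obj: "\<And>b. b \<in> UNIV \<Longrightarrow> (if b then X else Y) \<in> Obj C"
    using assms by simp
  show thesis
  proof (rule colimit_of_equations[OF universe category_axioms cocomplete fin Obj])
    fix S t
    assume t: "\<And>b. b \<in> UNIV \<Longrightarrow> t b \<in> hom C (if b then X else Y) S"
      and desc: "\<And>Z s. \<lbrakk>Z \<in> Obj C; \<And>b. b \<in> UNIV \<Longrightarrow> s b \<in> hom C (if b then X else Y) Z;
          \<And>i x j y. (i, x, j, y) \<in> {} \<Longrightarrow> s i \<cdot> x = s j \<cdot> y\<rbrakk> \<Longrightarrow>
        \<exists>h. h \<in> hom C S Z \<and> (\<forall>b\<in>UNIV. h \<cdot> t b = s b)"
      and eqI: "\<And>Z f g. \<lbrakk>f \<in> hom C S Z; g \<in> hom C S Z;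
          \<And>b. b \<in> UNIV \<Longrightarrow> f \<cdot> t b = g \<cdot> t b\<rbrakk> \<Longrightarrow> f = g"
    show thesis
    proof (rule that[of "t True" S "t False"])
      show "t True \<in> hom C X S" "t False \<in> hom C Y S"
        using t[of True] t[of False] by simp_all
      show "\<exists>h\<in>hom C S Z. h \<cdot> t True = f \<and> h \<cdot> t False = g"
        if f: "f \<in> hom C X Z" and g: "g \<in> hom C Y Z" for Z f g
      proof -
        have "\<exists>h. h \<in> hom C S Z \<and> (\<forall>b\<in>UNIV. h \<cdot> t b = (if b then f else g))"
          by (rule desc) (use f g hom_Obj(2)[OF f] in auto)
        then obtain h where h: "h \<in> hom C S Z" "\<And>b. h \<cdot> t b = (if b then f else g)"
          by blast
        show ?thesis
          using h(1) h(2)[of True] h(2)[of False] by auto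
      qed
      show "f = g" if f: "f \<in> hom C S Z" and g: "g \<in> hom C S Z"
        and eq: "f \<cdot> t True = g \<cdot> t True" "f \<cdot> t False = g \<cdot> t False" for Z f g
      proof (rule eqI[OF f g])
        fix b show "f \<cdot> t b = g \<cdot> t b"
          using eq by (cases b) simp_all
      qed
    qed
  qed auto
qed

lemma cokernel_pair_exists:
  assumes m: "m \<in> hom C A B"
  obtains P p q where "cokernel_pair C m P p q"
proof -
  have fin: "small U (UNIV :: bool set)" "small U {(False, m, True, m)}"
    by (simp_all add: small_finite[OF universe])
  have Obj: "\<And>b. b \<in> (UNIV :: bool set) \<Longrightarrow> B \<in> Obj C"
    using hom_Obj(2)[OF m] by simp
  show thesis
  proof (rule colimit_of_equations[OF universe category_axioms cocomplete fin Obj])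
    fix i x j y assume "(i, x, j, y) \<in> {(False, m, True, m)}"
    then show "i \<in> UNIV \<and> j \<in> UNIV \<and> (\<exists>W. x \<in> hom C W B \<and> y \<in> hom C W B)"
      using m by blast
  next
    fix P t
    assume t: "\<And>b :: bool. b \<in> UNIV \<Longrightarrow> t b \<in> hom C B P"
      and t_eq: "\<And>i x j y. (i, x, j, y) \<in> {(False, m, True, m)} \<Longrightarrow> t i \<cdot> x = t j \<cdot> y"
      and desc: "\<And>Z s. \<lbrakk>Z \<in> Obj C; \<And>b. b \<in> UNIV \<Longrightarrow> s b \<in> hom C B Z;
          \<And>i x j y. (i, x, j, y) \<in> {(False, m, True, m)} \<Longrightarrow> s i \<cdot> x = s j \<cdot> y\<rbrakk> \<Longrightarrow>
        \<exists>h. h \<in> hom C P Z \<and> (\<forall>b\<in>UNIV. h \<cdot> t b = s b)"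
      and eqI: "\<And>Z f g. \<lbrakk>f \<in> hom C P Z; g \<in> hom C P Z;
          \<And>b. b \<in> UNIV \<Longrightarrow> f \<cdot> t b = g \<cdot> t b\<rbrakk> \<Longrightarrow> f = g"
    have "cokernel_pair C m P (t False) (t True)"
      unfolding cokernel_pair_def
    proof (intro conjI allI ballI impI)
      show "m \<in> Arr C" "t False \<in> hom C (Cod C m) P" "t True \<in> hom C (Cod C m) P"
        using hom_ArrD[OF m] t by simp_all
      show "t False \<cdot> m = t True \<cdot> m"
        using t_eq by blast
      fix Z f g
      assume "f \<in> hom C (Cod C m) Z" "g \<in> hom C (Cod C m) Z" and eq: "f \<cdot> m = g \<cdot> m"
      then have f: "f \<in> hom C B Z" and g: "g \<in> hom C B Z"
        using hom_ArrD[OF m] by simp_all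
      have "\<exists>h. h \<in> hom C P Z \<and> (\<forall>b\<in>UNIV. h \<cdot> t b = (if b then g else f))"
        by (rule desc) (use f g eq hom_Obj(2)[OF f] in auto)
      then obtain h where h: "h \<in> hom C P Z" "\<And>b. h \<cdot> t b = (if b then g else f)"
        by blast
      show "\<exists>!h. h \<in> hom C P Z \<and> h \<cdot> t False = f \<and> h \<cdot> t True = g"
      proof (rule ex1I[of _ h])
        show "h \<in> hom C P Z \<and> h \<cdot> t False = f \<and> h \<cdot> t True = g"
          using h(1) h(2)[of True] h(2)[of False] by simp
        fix k assume k: "k \<in> hom C P Z \<and> k \<cdot> t False = f \<and> k \<cdot> t True = g"
        show "k = h"
        proof (rule eqI)
          fix b show "k \<cdot> t b = h \<cdot> t b"
            using k h(2)[of b] by (cases b) simp_all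
        qed (use k h(1) in auto)
      qed
    qed
    then show thesis
      using that by blast
  qed
qed

lemma joint_coequaliser:
  assumes D: "D \<in> Obj C" and R: "small U R"
    and pairs: "\<And>x y. (x, y) \<in> R \<Longrightarrow> \<exists>W. x \<in> hom C W D \<and> y \<in> hom C W D"
  obtains Q q where "q \<in> hom C D Q" "epimorphism C q" "\<And>x y. (x, y) \<in> R \<Longrightarrow> q \<cdot> x = q \<cdot> y"
    and "\<And>Z u. \<lbrakk>u \<in> hom C D Z; \<And>x y. (x, y) \<in> R \<Longrightarrow> u \<cdot> x = u \<cdot> y\<rbrakk> \<Longrightarrow> \<exists>h\<in>hom C Q Z. h \<cdot> q = u"
proof -
  let ?R = "(\<lambda>(x, y). ((), x, (), y)) ` R"
  have sm: "small U (UNIV :: unit set)" "small U ?R"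
    using R by (auto intro: small_finite[OF universe] small_image)
  have Obj: "\<And>b. b \<in> (UNIV :: unit set) \<Longrightarrow> D \<in> Obj C"
    using D by simp
  show thesis
  proof (rule colimit_of_equations[OF universe category_axioms cocomplete sm Obj])
    fix i x j y assume "(i, x, j, y) \<in> ?R"
    then show "i \<in> UNIV \<and> j \<in> UNIV \<and> (\<exists>W. x \<in> hom C W D \<and> y \<in> hom C W D)"
      using pairs by auto
  next
    fix Q t
    assume t: "\<And>b :: unit. b \<in> UNIV \<Longrightarrow> t b \<in> hom C D Q"
      and t_eq: "\<And>i x j y. (i, x, j, y) \<in> ?R \<Longrightarrow> t i \<cdot> x = t j \<cdot> y"
      and desc: "\<And>Z s. \<lbrakk>Z \<in> Obj C; \<And>b. b \<in> UNIV \<Longrightarrow> s b \<in> hom C D Z;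
          \<And>i x j y. (i, x, j, y) \<in> ?R \<Longrightarrow> s i \<cdot> x = s j \<cdot> y\<rbrakk> \<Longrightarrow>
        \<exists>h. h \<in> hom C Q Z \<and> (\<forall>b\<in>UNIV. h \<cdot> t b = s b)"
      and eqI: "\<And>Z f g. \<lbrakk>f \<in> hom C Q Z; g \<in> hom C Q Z;
          \<And>b. b \<in> UNIV \<Longrightarrow> f \<cdot> t b = g \<cdot> t b\<rbrakk> \<Longrightarrow> f = g"
    show thesis
    proof (rule that[of "t ()" Q])
      show q: "t () \<in> hom C D Q"
        using t by simp
      show "epimorphism C (t ())"
        by (rule epiI[OF q], rule eqI) simp_all
      show "t () \<cdot> x = t () \<cdot> y" if "(x, y) \<in> R" for x y
        by (rule t_eq) (use that in force)
      show "\<exists>h\<in>hom C Q Z. h \<cdot> t () = u"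
        if u: "u \<in> hom C D Z" and eq: "\<And>x y. (x, y) \<in> R \<Longrightarrow> u \<cdot> x = u \<cdot> y" for Z u
      proof -
        have "\<exists>h. h \<in> hom C Q Z \<and> (\<forall>b\<in>UNIV. h \<cdot> t b = u)"
          by (rule desc[of Z "\<lambda>_. u"]) (use u eq hom_Obj(2)[OF u] in auto)
        then show ?thesis
          by blast
      qed
    qed
  qed
qed

lemma coproduct_finitely_generated:
  assumes X: "finitely_generated U C X" and Y: "finitely_generated U C Y"
    and i: "i \<in> hom C X S" and j: "j \<in> hom C Y S"
    and desc: "\<And>Z f g. \<lbrakk>f \<in> hom C X Z; g \<in> hom C Y Z\<rbrakk> \<Longrightarrow> \<exists>h\<in>hom C S Z. h \<cdot> i = f \<and> h \<cdot> j = g"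
    and eqI: "\<And>Z f g. \<lbrakk>f \<in> hom C S Z; g \<in> hom C S Z; f \<cdot> i = g \<cdot> i; f \<cdot> j = g \<cdot> j\<rbrakk> \<Longrightarrow> f = g"
  shows "finitely_generated U C S"
proof (rule finitely_generatedI[OF hom_Obj(2)[OF i]])
  fix I r F Z t h
  assume F: "directed_diagram U C I r F" and mono: "\<forall>u\<in>r. monomorphism C (on_Arr F u)"
    and Z: "is_colimit (poset_cat I r) C F Z t" and h: "h \<in> hom C S Z"
  obtain a x where a: "a \<in> I" "x \<in> hom C X (on_Obj F a)" "t a \<cdot> x = h \<cdot> i"
    using finitely_generated_factor[OF X F mono Z Comp_in_hom[OF i h]] .
  obtain b y where b: "b \<in> I" "y \<in> hom C Y (on_Obj F b)" "t b \<cdot> y = h \<cdot> j"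
    using finitely_generated_factor[OF Y F mono Z Comp_in_hom[OF j h]] .
  obtain k where k: "k \<in> I" "(a, k) \<in> r" "(b, k) \<in> r"
    using directed_posetD(4)[OF directed_diagramD(2)[OF F] a(1) b(1)] by blast
  note Fa = diagram_functorD(2)[OF F k(2)] and Fb = diagram_functorD(2)[OF F k(3)]
  note t = diagram_cocone(2)[OF Z k(1)]
  obtain g where g: "g \<in> hom C S (on_Obj F k)"
      "g \<cdot> i = on_Arr F (a, k) \<cdot> x" "g \<cdot> j = on_Arr F (b, k) \<cdot> y"
    using desc[OF Comp_in_hom[OF a(2) Fa] Comp_in_hom[OF b(2) Fb]] by blast
  have "t k \<cdot> g = h"
  proof (rule eqI[OF Comp_in_hom[OF g(1) t] h])
    show "t k \<cdot> g \<cdot> i = h \<cdot> i"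
      using Comp_assoc[OF i g(1) t] g(2) a(3)
        Comp_eq_assoc[OF diagram_cocone(3)[OF Z k(2)] Fa t a(2)] by simp
    show "t k \<cdot> g \<cdot> j = h \<cdot> j"
      using Comp_assoc[OF j g(1) t] g(3) b(3)
        Comp_eq_assoc[OF diagram_cocone(3)[OF Z k(3)] Fb t b(2)] by simp
  qed
  then show "\<exists>i\<in>I. \<exists>g\<in>hom C S (on_Obj F i). t i \<cdot> g = h"
    using k(1) g(1) by blast
qed

text \<open>
  Lift against the colimit injection through which the composite with the quotient map factors.
\<close>

lemma strong_quotient_finitely_generated:
  assumes X: "finitely_generated U C X" and e: "strong_epi C e" "e \<in> hom C X Y"
  shows "finitely_generated U C Y"
proof (rule finitely_generatedI[OF hom_Obj(2)[OF e(2)]])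
  fix I r F Z t h
  assume F: "directed_diagram U C I r F" and mono: "\<forall>u\<in>r. monomorphism C (on_Arr F u)"
    and Z: "is_colimit (poset_cat I r) C F Z t" and h: "h \<in> hom C Y Z"
  obtain i x where i: "i \<in> I" "x \<in> hom C X (on_Obj F i)" "t i \<cdot> x = h \<cdot> e"
    using finitely_generated_factor[OF X F mono Z Comp_in_hom[OF e(2) h]] .
  obtain g where "g \<in> hom C Y (on_Obj F i)" "t i \<cdot> g = h"
    using strong_epi_hom(2)[OF e mono_colimit_injection[OF F mono Z i(1)]
        diagram_cocone(2)[OF Z i(1)] i(2) h i(3)] by blast
  then show "\<exists>i\<in>I. \<exists>g\<in>hom C Y (on_Obj F i). t i \<cdot> g = h"
    using i(1) by blast
qed

end

section \<open>Image factorisations\<close>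

context lfp_category
begin

text \<open>
  The joint coequaliser of all pairs of arrows from generators that \<open>d\<close> identifies. It is strong,
  because an arrow which coequalises these pairs after composition with a monomorphism coequalises
  them itself.
\<close>

lemma coequaliser_step:
  assumes d: "d \<in> hom C D B"
  obtains D' T d' where "T \<in> hom C D D'" "strong_epi C T" "d' \<in> hom C D' B" "d' \<cdot> T = d"
    and "\<And>g x y. \<lbrakk>g \<in> G; x \<in> hom C g D; y \<in> hom C g D; d \<cdot> x = d \<cdot> y\<rbrakk> \<Longrightarrow> T \<cdot> x = T \<cdot> y"
proof -
  let ?R = "{(x, y). d \<cdot> x = d \<cdot> y \<and> (\<exists>g\<in>G. x \<in> hom C g D \<and> y \<in> hom C g D)}"
  have D: "D \<in> Obj C"
    using hom_Obj(1)[OF d] .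
  have "small U (\<Union>g\<in>G. hom C g D \<times> hom C g D)"
    by (intro small_UN small_Times universe small_G small_hom G_Obj D)
  then have R: "small U ?R"
    by (rule small_subset) auto
  obtain D' T where T: "T \<in> hom C D D'" "epimorphism C T"
      and T_eq: "\<And>x y. (x, y) \<in> ?R \<Longrightarrow> T \<cdot> x = T \<cdot> y"
      and desc: "\<And>Z u. \<lbrakk>u \<in> hom C D Z; \<And>x y. (x, y) \<in> ?R \<Longrightarrow> u \<cdot> x = u \<cdot> y\<rbrakk> \<Longrightarrow>
        \<exists>h\<in>hom C D' Z. h \<cdot> T = u"
    using joint_coequaliser[OF D R] by (smt (verit, best) case_prodD mem_Collect_eq)
  have "strong_epi C T"
  proof (rule strong_epiI[OF T])
    fix n M N u v
    assume n: "monomorphism C n" "n \<in> hom C M N" and u: "u \<in> hom C D M"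
      and v: "v \<in> hom C D' N" and eq: "n \<cdot> u = v \<cdot> T"
    show "\<exists>k\<in>hom C D' M. k \<cdot> T = u"
    proof (rule desc[OF u])
      fix x y assume xy: "(x, y) \<in> ?R"
      then obtain g where x: "x \<in> hom C g D" and y: "y \<in> hom C g D"
        by blast
      have "n \<cdot> (u \<cdot> x) = n \<cdot> (u \<cdot> y)"
        using Comp_eq_assoc[OF eq u n(2) x] Comp_eq_assoc[OF eq u n(2) y]
          Comp_assoc[OF x T(1) v] Comp_assoc[OF y T(1) v] T_eq[OF xy] by simp
      then show "u \<cdot> x = u \<cdot> y"
        by (rule monoD[OF n Comp_in_hom[OF x u] Comp_in_hom[OF y u]])
    qed
  qed
  moreover obtain d' where "d' \<in> hom C D' B" "d' \<cdot> T = d"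
    using desc[OF d] by blast
  ultimately show thesis
    using that[OF T(1), of d'] T_eq by blast
qed

end

text \<open>
  Iterating the preceding construction: strong quotients of \<open>Y\<close> through which \<open>f\<close> factors, where
  pairs of arrows from generators that become equal in \<open>B\<close> are already identified one step later.
\<close>

locale image_chain = lfp_category +
  fixes f Y B D e d
  assumes e: "\<And>n. e n \<in> hom C Y (D n)" and e_strong: "\<And>n. strong_epi C (e n)"
    and d: "\<And>n. d n \<in> hom C (D n) B" and d_e: "\<And>n. d n \<cdot> e n = f"
    and step: "\<And>n. \<exists>T\<in>hom C (D n) (D (Suc n)). T \<cdot> e n = e (Suc n) \<and>
      (\<forall>g\<in>G. \<forall>x\<in>hom C g (D n). \<forall>y\<in>hom C g (D n). d n \<cdot> x = d n \<cdot> y \<longrightarrow> T \<cdot> x = T \<cdot> y)"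
begin

lemma e_epi: "epimorphism C (e n)"
  using strong_epi_hom(1)[OF e_strong e] .

lemma from_stage_eqI:
  "\<lbrakk>h \<in> hom C (D n) Z; k \<in> hom C (D n) Z; h \<cdot> e n = k \<cdot> e n\<rbrakk> \<Longrightarrow> h = k"
  using epiD[OF e_epi e] .

text \<open>
  As \<open>e n\<close> is an epimorphism, there is only one arrow \<open>D n \<rightarrow> D m\<close> under \<open>Y\<close>; uniqueness
  makes these arrows functorial.
\<close>

definition transition :: "nat \<Rightarrow> nat \<Rightarrow> 'b" where
  "transition n m = (SOME h. h \<in> hom C (D n) (D m) \<and> h \<cdot> e n = e m)"

lemma transition:
  assumes "n \<le> m"
  shows "transition n m \<in> hom C (D n) (D m)" and "transition n m \<cdot> e n = e m"
proof -
  have "\<exists>h. h \<in> hom C (D n) (D m) \<and> h \<cdot> e n = e m"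
    using assms
  proof (induction m rule: dec_induct)
    case base
    then show ?case
      using Ide_Comp[OF e] Ide_in_hom[OF hom_Obj(2)[OF e]] by blast
  next
    case (step m)
    then obtain h where h: "h \<in> hom C (D n) (D m)" "h \<cdot> e n = e m"
      by blast
    obtain T where T: "T \<in> hom C (D m) (D (Suc m))" "T \<cdot> e m = e (Suc m)"
      using image_chain.step[OF image_chain_axioms] by blast
    show ?case
      using Comp_in_hom[OF h(1) T(1)] Comp_assoc[OF e h(1) T(1)] h(2) T(2) by auto
  qed
  then have "transition n m \<in> hom C (D n) (D m) \<and> transition n m \<cdot> e n = e m"
    unfolding transition_def by (rule someI_ex)
  then show "transition n m \<in> hom C (D n) (D m)" and "transition n m \<cdot> e n = e m"
    by auto
qed

lemma transition_Comp:
  assumes "n \<le> m" "m \<le> k"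
  shows "transition m k \<cdot> transition n m = transition n k"
proof (rule from_stage_eqI)
  note h = transition[OF assms(1)] and k = transition[OF assms(2)]
  show "transition m k \<cdot> transition n m \<in> hom C (D n) (D k)"
    using Comp_in_hom[OF h(1) k(1)] .
  show "transition n k \<in> hom C (D n) (D k)"
    using transition(1) assms by simp
  show "transition m k \<cdot> transition n m \<cdot> e n = transition n k \<cdot> e n"
    using Comp_assoc[OF e h(1) k(1)] h(2) k(2) transition(2)[of n k] assms by simp
qed

lemma transition_refl: "transition n n = Ide C (D n)"
  by (rule from_stage_eqI)
    (use transition[of n n] Ide_Comp[OF e] Ide_in_hom[OF hom_Obj(2)[OF e]] in auto)

lemma d_transition:
  assumes "n \<le> m"
  shows "d m \<cdot> transition n m = d n"
proof (rule from_stage_eqI)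
  note h = transition[OF assms]
  show "d m \<cdot> transition n m \<in> hom C (D n) B"
    using Comp_in_hom[OF h(1) d] .
  show "d m \<cdot> transition n m \<cdot> e n = d n \<cdot> e n"
    using Comp_assoc[OF e h(1) d] h(2) d_e by simp
qed (rule d)

lemma transition_identifies:
  assumes g: "g \<in> G" and x: "x \<in> hom C g (D n)" and y: "y \<in> hom C g (D n)"
    and eq: "d n \<cdot> x = d n \<cdot> y"
  shows "transition n (Suc n) \<cdot> x = transition n (Suc n) \<cdot> y"
proof -
  obtain T where T: "T \<in> hom C (D n) (D (Suc n))" "T \<cdot> e n = e (Suc n)" "T \<cdot> x = T \<cdot> y"
    using step[of n] g x y eq by blast
  have "T = transition n (Suc n)"
    by (rule from_stage_eqI[OF T(1)]) (use transition[of n "Suc n"] T(2) in simp_all)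
  then show ?thesis
    using T(3) by simp
qed

text \<open>
  If two arrows from a finitely presentable object into the colimit of the chain are identified in
  \<open>B\<close>, they live on a common stage and are coequalised at the next one.
\<close>

lemma image_of_countable_chain:
  assumes small: "small U (UNIV :: nat set)"
  obtains Q k q where "k \<in> hom C Y Q" "strong_epi C k" "q \<in> hom C Q B" "monomorphism C q" "q \<cdot> k = f"
proof -
  \<comment> \<open>The diagrams that finitely presentable objects are tested on have shapes in the universe,
    so the chain is indexed by a copy of \<open>\<nat>\<close> there.\<close>
  obtain \<nu> :: "nat \<Rightarrow> 'c" where \<nu>: "inj \<nu>"
    using small_embedding[OF small] .
  define I where "I = range \<nu>"
  define r where "r = {(\<nu> n, \<nu> m) | n m. n \<le> m}"
  have r_iff: "(\<nu> n, \<nu> m) \<in> r \<longleftrightarrow> n \<le> m" for n m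
    using \<nu> by (auto simp: r_def inj_eq)
  have "\<exists>k\<in>I. (a, k) \<in> r \<and> (b, k) \<in> r" if a: "a \<in> I" and b: "b \<in> I" for a b
  proof -
    obtain n m where ab: "a = \<nu> n" "b = \<nu> m"
      using a b unfolding I_def by blast
    then show ?thesis
      by (intro bexI[of _ "\<nu> (max n m)"]) (simp_all add: I_def r_iff)
  qed
  then have r: "directed_poset I r"
    unfolding directed_poset_def partial_order_on_def preorder_on_def refl_on_def trans_def antisym_def
    using \<nu> by (auto simp: I_def r_def inj_eq)
  have I: "small U I"
    unfolding I_def using small by (rule small_image)
  then have "small U (I \<times> I)"
    by (intro small_Times universe)
  then have "small U (Arr (poset_cat I r))"
    by (rule small_subset) (auto simp: I_def r_def)
  note J = category_poset_cat[OF r] this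
  define F where "F = \<lparr>on_Obj = D \<circ> inv \<nu>, on_Arr = \<lambda>(a, b). transition (inv \<nu> a) (inv \<nu> b)\<rparr>"
  have F_simps: "on_Obj F (\<nu> n) = D n" "on_Arr F (\<nu> n, \<nu> m) = transition n m" for n m
    using \<nu> by (simp_all add: F_def)
  have F: "is_functor (poset_cat I r) C F"
    unfolding is_functor_def
    using hom_Obj(1)[OF d] transition(1) transition_refl transition_Comp
    by (auto simp: I_def r_def F_simps \<nu>[THEN inj_eq])
  have dF: "directed_diagram U C I r F"
    using I r F by (simp add: directed_diagram_def)
  obtain Q s where Q: "is_colimit (poset_cat I r) C F Q s"
    using colimit_small_shape[OF J category_axioms cocomplete F] .
  define t where "t n = s (\<nu> n)" for n
  have t: "t n \<in> hom C (D n) Q" for n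
    using diagram_cocone(2)[OF Q, of "\<nu> n"] by (simp add: I_def F_simps t_def)
  have t_transition: "t m \<cdot> transition n m = t n" if "n \<le> m" for n m
    using diagram_cocone(3)[OF Q, of "\<nu> n" "\<nu> m"] that by (simp add: r_iff F_simps t_def)
  have desc: "\<exists>h\<in>hom C Q Z. \<forall>n. h \<cdot> t n = u n"
    if u: "\<And>n. u n \<in> hom C (D n) Z" "\<And>n m. n \<le> m \<Longrightarrow> u m \<cdot> transition n m = u n" for Z u
  proof -
    have "is_cocone (poset_cat I r) C F Z (u \<circ> inv \<nu>)"
      unfolding is_cocone_def
      using hom_Obj(2)[OF u(1)] u \<nu> by (auto simp: I_def r_def F_simps)
    then obtain h where "h \<in> hom C Q Z" "\<And>i. i \<in> I \<Longrightarrow> h \<cdot> s i = (u \<circ> inv \<nu>) i"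
      using colimit_desc[OF Q] by (metis poset_cat_simps(1))
    then show ?thesis
      using \<nu> by (intro bexI[of _ h]) (simp_all add: I_def t_def)
  qed
  have eqI: "h = h'" if "h \<in> hom C Q Z" "h' \<in> hom C Q Z" "\<And>n. h \<cdot> t n = h' \<cdot> t n" for Z h h'
    by (rule colimit_eqI[OF Q J(1) F that(1,2)]) (use that(3) in \<open>auto simp: I_def t_def\<close>)
  define k where "k = t 0 \<cdot> e 0"
  have k: "k \<in> hom C Y Q"
    unfolding k_def using Comp_in_hom[OF e t] .
  have te: "t n \<cdot> e n = k" for n
    unfolding k_def
    using Comp_eq_assoc[OF t_transition[of 0 n] transition(1)[of 0 n] t e] transition(2)[of 0 n] by simp
  have k_epi: "epimorphism C k"
  proof (rule epiI[OF k])
    fix Z h h' assume h: "h \<in> hom C Q Z" and h': "h' \<in> hom C Q Z" and eq: "h \<cdot> k = h' \<cdot> k"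
    show "h = h'"
    proof (rule eqI[OF h h'], rule from_stage_eqI[OF Comp_in_hom[OF t h] Comp_in_hom[OF t h']])
      fix n show "h \<cdot> t n \<cdot> e n = h' \<cdot> t n \<cdot> e n"
        using Comp_assoc[OF e t h] Comp_assoc[OF e t h'] te eq by simp
    qed
  qed
  have "strong_epi C k"
  proof (rule strong_epiI[OF k k_epi])
    fix n M N u v
    assume n: "monomorphism C n" "n \<in> hom C M N" and u: "u \<in> hom C Y M"
      and v: "v \<in> hom C Q N" and eq: "n \<cdot> u = v \<cdot> k"
    have "\<exists>\<delta>\<in>hom C (D i) M. \<delta> \<cdot> e i = u" for i
    proof -
      have "n \<cdot> u = v \<cdot> t i \<cdot> e i"
        using eq te Comp_assoc[OF e t v] by simp
      then show ?thesis
        using strong_epi_hom(2)[OF e_strong e n u Comp_in_hom[OF t v]] by blast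
    qed
    then obtain \<delta> where \<delta>: "\<And>i. \<delta> i \<in> hom C (D i) M" "\<And>i. \<delta> i \<cdot> e i = u"
      by metis
    have "\<delta> j \<cdot> transition i j = \<delta> i" if "i \<le> j" for i j
    proof (rule from_stage_eqI[OF Comp_in_hom[OF transition(1)[OF that] \<delta>(1)] \<delta>(1)])
      show "\<delta> j \<cdot> transition i j \<cdot> e i = \<delta> i \<cdot> e i"
        using Comp_assoc[OF e transition(1)[OF that] \<delta>(1)] transition(2)[OF that] \<delta>(2) by simp
    qed
    then obtain h where h: "h \<in> hom C Q M" "\<And>i. h \<cdot> t i = \<delta> i"
      using desc[of \<delta>, OF \<delta>(1)] by blast
    have "h \<cdot> k = u"
      using Comp_assoc[OF e t h(1), of 0] h(2) \<delta>(2) by (simp add: k_def)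
    then show "\<exists>h\<in>hom C Q M. h \<cdot> k = u"
      using h(1) by blast
  qed
  moreover obtain q where q: "q \<in> hom C Q B" "\<And>n. q \<cdot> t n = d n"
    using desc[of d, OF d d_transition] by blast
  moreover have "monomorphism C q"
  proof (rule mono_on_GI[OF q(1)])
    fix g x y
    assume g: "g \<in> G" and x: "x \<in> hom C g Q" and y: "y \<in> hom C g Q" and eq: "q \<cdot> x = q \<cdot> y"
    obtain i x' where x': "i \<in> I" "x' \<in> hom C g (on_Obj F i)" "s i \<cdot> x' = x"
      using G_factor[OF g dF Q x] .
    then obtain n where n: "x' \<in> hom C g (D n)" "t n \<cdot> x' = x"
      by (auto simp: I_def t_def F_simps)
    obtain j y' where y': "j \<in> I" "y' \<in> hom C g (on_Obj F j)" "s j \<cdot> y' = y"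
      using G_factor[OF g dF Q y] .
    then obtain m where m: "y' \<in> hom C g (D m)" "t m \<cdot> y' = y"
      by (auto simp: I_def t_def F_simps)
    define l where "l = max n m"
    have l: "n \<le> l" "m \<le> l"
      by (simp_all add: l_def)
    define x'' where "x'' = transition n l \<cdot> x'"
    define y'' where "y'' = transition m l \<cdot> y'"
    have x'': "x'' \<in> hom C g (D l)" "t l \<cdot> x'' = x"
      using Comp_in_hom[OF n(1) transition(1)[OF l(1)]] n(2)
        Comp_eq_assoc[OF t_transition[OF l(1)] transition(1)[OF l(1)] t n(1)] by (simp_all add: x''_def)
    have y'': "y'' \<in> hom C g (D l)" "t l \<cdot> y'' = y"
      using Comp_in_hom[OF m(1) transition(1)[OF l(2)]] m(2)
        Comp_eq_assoc[OF t_transition[OF l(2)] transition(1)[OF l(2)] t m(1)] by (simp_all add: y''_def)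
    have "d l \<cdot> x'' = d l \<cdot> y''"
      using Comp_eq_assoc[OF q(2) t q(1) x''(1)] Comp_eq_assoc[OF q(2) t q(1) y''(1)]
        x''(2) y''(2) eq by simp
    then have T: "transition l (Suc l) \<cdot> x'' = transition l (Suc l) \<cdot> y''"
      by (rule transition_identifies[OF g x''(1) y''(1)])
    have T_hom: "transition l (Suc l) \<in> hom C (D l) (D (Suc l))"
      by (rule transition) simp
    have T_t: "t (Suc l) \<cdot> transition l (Suc l) = t l"
      by (rule t_transition) simp
    show "x = y"
      using Comp_eq_assoc[OF T_t T_hom t x''(1)] Comp_eq_assoc[OF T_t T_hom t y''(1)]
        T x''(2) y''(2) by simp
  qed
  moreover have "q \<cdot> k = f"
    using Comp_assoc[OF e t q(1), of 0] q(2) d_e by (simp add: k_def)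
  ultimately show thesis
    using that k by blast
qed

end

context lfp_category
begin

lemma small_imp_finite:
  assumes "\<not> small U (UNIV :: nat set)" "small U A"
  shows "finite A"
proof (rule ccontr)
  assume "infinite A"
  then have "(UNIV :: nat set) \<lesssim> A"
    by (rule infinite_le_lepoll[THEN iffD1])
  then show False
    using assms lesspoll_trans1 unfolding small_def by blast
qed

text \<open>A finite directed poset has a greatest element, at which the colimit is attained.\<close>

lemma retract_of_generator:
  assumes fin: "\<not> small U (UNIV :: nat set)" and X: "X \<in> Obj C"
  obtains g s p where "g \<in> G" "s \<in> hom C X g" "p \<in> hom C g X" "p \<cdot> s = Ide C X"
proof -
  obtain I r F t where F: "directed_diagram U C I r F" and FG: "\<And>i. i \<in> I \<Longrightarrow> on_Obj F i \<in> G"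
    and lim: "is_colimit (poset_cat I r) C F X t"
    using G_directed_colimit[OF X] by blast
  note dF = directed_diagramD[OF F]
  note dr = directed_posetD[OF dF(2)]
  note t = diagram_cocone[OF lim]
  note fF = diagram_functorD[OF F]
  have "\<exists>k\<in>I. \<forall>i\<in>S. (i, k) \<in> r" if "finite S" "S \<subseteq> I" for S
    using that
  proof (induction S rule: finite_induct)
    case empty
    then show ?case using dr(5) by blast
  next
    case (insert a S)
    then obtain k where k: "k \<in> I" "\<forall>i\<in>S. (i, k) \<in> r"
      by blast
    obtain l where "l \<in> I" "(a, l) \<in> r" "(k, l) \<in> r"
      using dr(4)[of a k] k(1) insert.prems by blast
    then show ?case
      using k(2) dr(3) by blast
  qed
  from this[OF small_imp_finite[OF fin dF(1)] subset_refl]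
  obtain k where k: "k \<in> I" "\<And>i. i \<in> I \<Longrightarrow> (i, k) \<in> r"
    by blast
  have "is_cocone (poset_cat I r) C F (on_Obj F k) (\<lambda>i. on_Arr F (i, k))"
    unfolding is_cocone_def
  proof (intro conjI ballI)
    fix u assume "u \<in> Arr (poset_cat I r)"
    then obtain i j where u: "u = (i, j)" "(i, j) \<in> r"
      by (cases u) auto
    then show "on_Arr F (Cod (poset_cat I r) u, k) \<cdot> on_Arr F u = on_Arr F (Dom (poset_cat I r) u, k)"
      using fF(3)[OF u(2) k(2)] dr(2)[OF u(2)] by simp
  qed (use fF k in auto)
  then obtain s where s: "s \<in> hom C X (on_Obj F k)" "\<And>i. i \<in> I \<Longrightarrow> s \<cdot> t i = on_Arr F (i, k)"
    using colimit_desc[OF lim] by (metis poset_cat_simps(1))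
  have "t k \<cdot> s = Ide C X"
  proof (rule colimit_eqI[OF lim dF(4,3) Comp_in_hom[OF s(1) t(2)[OF k(1)]] Ide_in_hom[OF X]])
    fix i assume "i \<in> Obj (poset_cat I r)"
    then have i: "i \<in> I" by simp
    show "t k \<cdot> s \<cdot> t i = Ide C X \<cdot> t i"
      using Comp_assoc[OF t(2)[OF i] s(1) t(2)[OF k(1)]] s(2)[OF i] t(3)[OF k(2)[OF i]]
        Ide_Comp[OF t(2)[OF i]] by simp
  qed
  then show thesis
    using that[OF FG[OF k(1)] s(1) t(2)[OF k(1)]] by blast
qed

end

context image_chain
begin

text \<open>
  When all small sets are finite, \<open>\<nat>\<close> is too large to index a colimit. But then the numbers of
  arrows from the stages to the finitely many generators cannot decrease forever. As a stage is a
  retract of a generator, a step at which none of these arrows is lost has a retraction.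
\<close>

lemma mono_stage_if_small_finite:
  assumes fin: "\<not> small U (UNIV :: nat set)"
  obtains n where "monomorphism C (d n)"
proof -
  have finG: "finite G"
    using small_imp_finite[OF fin small_G] .
  have DObj: "D n \<in> Obj C" for n
    using hom_Obj(1)[OF d] .
  have fin_hom: "finite (hom C (D n) g)" if "g \<in> G" for n g
    using small_imp_finite[OF fin small_hom[OF DObj G_Obj[OF that]]] .
  define T where "T n = transition n (Suc n)" for n
  have T: "T n \<in> hom C (D n) (D (Suc n))" "T n \<cdot> e n = e (Suc n)" for n
    using transition[of n "Suc n"] by (simp_all add: T_def)
  have sub: "(\<lambda>h. h \<cdot> T n) ` hom C (D (Suc n)) g \<subseteq> hom C (D n) g" for n g
    using Comp_in_hom[OF T(1)] by blast
  have inj: "inj_on (\<lambda>h. h \<cdot> T n) (hom C (D (Suc n)) g)" for n g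
  proof (rule inj_onI)
    fix h k assume h: "h \<in> hom C (D (Suc n)) g" and k: "k \<in> hom C (D (Suc n)) g"
      and eq: "h \<cdot> T n = k \<cdot> T n"
    show "h = k"
      by (rule from_stage_eqI[OF h k])
        (use Comp_assoc[OF e T(1) h] Comp_assoc[OF e T(1) k] T(2) eq in simp)
  qed
  have le: "card (hom C (D (Suc n)) g) \<le> card (hom C (D n) g)" if "g \<in> G" for n g
    using card_mono[OF fin_hom[OF that] sub] card_image[OF inj] by metis
  define c where "c n = (\<Sum>g\<in>G. card (hom C (D n) g))" for n
  obtain n where n: "c n \<le> c (Suc n)"
    using ex_has_least_nat[of "\<lambda>_. True" 0 c] by blast
  moreover have "c (Suc n) \<le> c n"
    unfolding c_def by (rule sum_mono) (rule le)
  ultimately have "c (Suc n) = c n"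
    by simp
  then have card_eq: "card (hom C (D (Suc n)) g) = card (hom C (D n) g)" if "g \<in> G" for g
    using sum_mono_inv[of "\<lambda>g. card (hom C (D (Suc n)) g)" G "\<lambda>g. card (hom C (D n) g)" g]
      le that finG unfolding c_def by blast
  have surj: "(\<lambda>h. h \<cdot> T n) ` hom C (D (Suc n)) g = hom C (D n) g" if "g \<in> G" for g
    using card_subset_eq[OF fin_hom[OF that] sub] card_image[OF inj] card_eq[OF that] by metis
  obtain g s p where g: "g \<in> G" and s: "s \<in> hom C (D n) g" and p: "p \<in> hom C g (D n)"
    and ps: "p \<cdot> s = Ide C (D n)"
    using retract_of_generator[OF fin DObj] .
  have "s \<in> (\<lambda>h. h \<cdot> T n) ` hom C (D (Suc n)) g"
    using s surj[OF g] by simp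
  then obtain h where h: "h \<in> hom C (D (Suc n)) g" "h \<cdot> T n = s"
    by auto
  have "p \<cdot> h \<cdot> T n = Ide C (D n)"
    using Comp_assoc[OF T(1) h(1) p] h(2) ps by simp
  then have T_mono: "monomorphism C (T n)"
    by (rule split_mono[OF T(1) Comp_in_hom[OF h(1) p]])
  have "monomorphism C (d n)"
  proof (rule mono_on_GI[OF d])
    fix g x y
    assume g: "g \<in> G" and x: "x \<in> hom C g (D n)" and y: "y \<in> hom C g (D n)"
      and eq: "d n \<cdot> x = d n \<cdot> y"
    have "T n \<cdot> x = T n \<cdot> y"
      unfolding T_def by (rule transition_identifies[OF g x y eq])
    then show "x = y"
      by (rule monoD[OF T_mono T(1) x y])
  qed
  then show thesis
    using that by blast
qed

end

context lfp_category
begin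

lemma image_factorisation:
  assumes f: "f \<in> hom C Y B"
  obtains Q k q where "k \<in> hom C Y Q" "strong_epi C k" "q \<in> hom C Q B" "monomorphism C q" "q \<cdot> k = f"
proof -
  let ?P = "\<lambda>(D, e, d). e \<in> hom C Y D \<and> strong_epi C e \<and> d \<in> hom C D B \<and> d \<cdot> e = f"
  let ?Q = "\<lambda>(D, e, d) (D', e', d'). \<exists>T\<in>hom C D D'. T \<cdot> e = e' \<and>
    (\<forall>g\<in>G. \<forall>x\<in>hom C g D. \<forall>y\<in>hom C g D. d \<cdot> x = d \<cdot> y \<longrightarrow> T \<cdot> x = T \<cdot> y)"
  have "\<exists>\<sigma>. \<forall>n :: nat. ?P (\<sigma> n) \<and> ?Q (\<sigma> n) (\<sigma> (Suc n))"
  proof (rule dependent_nat_choice)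
    have Y: "Y \<in> Obj C"
      using hom_Obj(1)[OF f] .
    have "?P (Y, Ide C Y, f)"
      using Ide_in_hom[OF Y] strong_epi_Ide[OF Y] f Comp_Ide[OF f] by simp
    then show "\<exists>a. ?P a" ..
  next
    fix a and n :: nat assume "?P a"
    obtain D e d where a: "a = (D, e, d)"
      by (cases a)
    have e: "e \<in> hom C Y D" "strong_epi C e" and d: "d \<in> hom C D B" and de: "d \<cdot> e = f"
      using \<open>?P a\<close> by (simp_all add: a)
    obtain D' T d' where T: "T \<in> hom C D D'" "strong_epi C T" and d': "d' \<in> hom C D' B" "d' \<cdot> T = d"
      and id: "\<And>g x y. \<lbrakk>g \<in> G; x \<in> hom C g D; y \<in> hom C g D; d \<cdot> x = d \<cdot> y\<rbrakk> \<Longrightarrow> T \<cdot> x = T \<cdot> y"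
      by (rule coequaliser_step[OF d]) (rule that; assumption)
    have "?P (D', T \<cdot> e, d')"
      using Comp_in_hom[OF e(1) T(1)] strong_epi_Comp[OF e(2,1) T(2,1)] d'
        Comp_eq_assoc[OF d'(2) T(1) d'(1) e(1)] de by simp
    moreover have "?Q a (D', T \<cdot> e, d')"
      using T(1) id by (auto simp: a)
    ultimately show "\<exists>b. ?P b \<and> ?Q a b"
      by blast
  qed
  then obtain \<sigma> where \<sigma>: "\<forall>n :: nat. ?P (\<sigma> n) \<and> ?Q (\<sigma> n) (\<sigma> (Suc n))" ..
  then have P: "?P (\<sigma> n)" and Q: "?Q (\<sigma> n) (\<sigma> (Suc n))" for n
    by simp_all
  interpret image_chain C U G f Y B "\<lambda>n. fst (\<sigma> n)" "\<lambda>n. fst (snd (\<sigma> n))" "\<lambda>n. snd (snd (\<sigma> n))"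
  proof unfold_locales
    fix n
    show "fst (snd (\<sigma> n)) \<in> hom C Y (fst (\<sigma> n))" "strong_epi C (fst (snd (\<sigma> n)))"
      "snd (snd (\<sigma> n)) \<in> hom C (fst (\<sigma> n)) B" "snd (snd (\<sigma> n)) \<cdot> fst (snd (\<sigma> n)) = f"
      using P[of n] by (simp_all add: case_prod_beta)
    show "\<exists>T\<in>hom C (fst (\<sigma> n)) (fst (\<sigma> (Suc n))). T \<cdot> fst (snd (\<sigma> n)) = fst (snd (\<sigma> (Suc n))) \<and>
      (\<forall>g\<in>G. \<forall>x\<in>hom C g (fst (\<sigma> n)). \<forall>y\<in>hom C g (fst (\<sigma> n)).
        snd (snd (\<sigma> n)) \<cdot> x = snd (snd (\<sigma> n)) \<cdot> y \<longrightarrow> T \<cdot> x = T \<cdot> y)"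
      using Q[of n] unfolding case_prod_beta .
  qed
  show thesis
  proof (cases "small U (UNIV :: nat set)")
    case True
    then show ?thesis
      using image_of_countable_chain that by blast
  next
    case False
    then obtain n where "monomorphism C (snd (snd (\<sigma> n)))"
      using mono_stage_if_small_finite by blast
    then show ?thesis
      using that[OF e e_strong d _ d_e] by blast
  qed
qed

end

section \<open>Monomorphisms as equalisers of their cokernel pairs\<close>

context category
begin

lemma amalgamate:
  assumes AP: "amalgamation_property C"
    and a: "monomorphism C a" "a \<in> hom C X Y" and b: "monomorphism C b" "b \<in> hom C X Z"
  obtains R c d where "c \<in> hom C Y R" "monomorphism C c" "d \<in> hom C Z R" "monomorphism C d" "c \<cdot> a = d \<cdot> b"
proof -
  have "Dom C a = Dom C b"
    using a(2) b(2) by (simp add: hom_def)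
  then obtain d c where dc: "monomorphism C d" "monomorphism C c" "Dom C c = Cod C a" "Dom C d = Cod C b"
      "Cod C c = Cod C d" "c \<cdot> a = d \<cdot> b"
    using AP a(1) b(1) unfolding amalgamation_property_def by meson
  have "c \<in> hom C Y (Cod C d)" "d \<in> hom C Z (Cod C d)"
    using dc a(2) b(2) by (simp_all add: hom_def monomorphism_def)
  then show thesis
    using that dc by meson
qed

lemma iso_if_mono_extremal_epi:
  assumes e: "extremal_epi C e" and m: "monomorphism C e" and h: "e \<in> hom C X Y"
  shows "isomorphism C e"
proof -
  have "Ide C X \<in> hom C (Dom C e) (Dom C e)" "e = e \<cdot> Ide C X"
    using hom_ArrD[OF h] Ide_in_hom[OF hom_Obj(1)[OF h]] Comp_Ide[OF h] by simp_all
  then show ?thesis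
    using e m unfolding extremal_epi_def by meson
qed

end

context lfp_category
begin

text \<open>
  The last hypothesis says that \<open>d \<cdot> b\<close> lies in the dominion of \<open>d \<cdot> e\<close>: arrows that agree on
  \<open>d \<cdot> e\<close> agree on it. Both legs \<open>u\<close>, \<open>v\<close> of
  the cokernel pair of \<open>e\<close> are split monomorphisms, hence can be amalgamated with \<open>d\<close>, and the
  results with each other: this extends \<open>u\<close> and \<open>v\<close>, up to a monomorphism, to arrows on \<open>B\<close> which
  agree on \<open>d \<cdot> e\<close>. So \<open>u\<close> and \<open>v\<close> agree on \<open>b\<close> as well, and since \<open>D\<close> is generated by \<open>e\<close> and
  \<open>b\<close> they are equal.
\<close>

lemma epi_into_dominion:
  assumes AP: "amalgamation_property C"
    and e: "e \<in> hom C A D" and d: "monomorphism C d" "d \<in> hom C D B"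
    and b: "b \<in> hom C X D"
    and generated: "\<And>Z u v. \<lbrakk>u \<in> hom C D Z; v \<in> hom C D Z; u \<cdot> e = v \<cdot> e; u \<cdot> b = v \<cdot> b\<rbrakk> \<Longrightarrow> u = v"
    and dominion: "\<And>Z f f'. \<lbrakk>f \<in> hom C B Z; f' \<in> hom C B Z; f \<cdot> (d \<cdot> e) = f' \<cdot> (d \<cdot> e)\<rbrakk> \<Longrightarrow>
      f \<cdot> (d \<cdot> b) = f' \<cdot> (d \<cdot> b)"
  shows "epimorphism C e"
proof -
  obtain Q u v where Q: "cokernel_pair C e Q u v"
    using cokernel_pair_exists[OF e] .
  note u = cokernel_pairD(1)[OF Q e] and v = cokernel_pairD(2)[OF Q e] and uv = cokernel_pairD(3)[OF Q e]
  have IdeD: "Ide C D \<in> hom C D D"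
    using Ide_in_hom[OF hom_Obj(2)[OF e]] .
  obtain n where n: "n \<in> hom C Q D" "n \<cdot> u = Ide C D" "n \<cdot> v = Ide C D"
    using cokernel_pairD(4)[OF Q e IdeD IdeD refl] by blast
  have u_mono: "monomorphism C u" and v_mono: "monomorphism C v"
    using split_mono[OF u n(1,2)] split_mono[OF v n(1,3)] .
  obtain R1 w1 r1 where R1: "w1 \<in> hom C Q R1" "monomorphism C w1" "r1 \<in> hom C B R1" "w1 \<cdot> u = r1 \<cdot> d"
    using amalgamate[OF AP u_mono u d] by metis
  obtain R2 w2 r2 where R2: "w2 \<in> hom C Q R2" "monomorphism C w2" "r2 \<in> hom C B R2" "w2 \<cdot> v = r2 \<cdot> d"
    using amalgamate[OF AP v_mono v d] by metis
  obtain S s1 s2 where S: "s1 \<in> hom C R1 S" "monomorphism C s1" "s2 \<in> hom C R2 S"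
      "s1 \<cdot> w1 = s2 \<cdot> w2"
    using amalgamate[OF AP R1(2,1) R2(2,1)] by metis
  define w where "w = s1 \<cdot> w1"
  define f where "f = s1 \<cdot> r1"
  define f' where "f' = s2 \<cdot> r2"
  have w: "w \<in> hom C Q S" "monomorphism C w"
    unfolding w_def using Comp_in_hom[OF R1(1) S(1)] mono_Comp[OF R1(2,1) S(2,1)] .
  have f: "f \<in> hom C B S" and f': "f' \<in> hom C B S"
    unfolding f_def f'_def using Comp_in_hom[OF R1(3) S(1)] Comp_in_hom[OF R2(3) S(3)] .
  have wu: "w \<cdot> u = f \<cdot> d"
    unfolding w_def f_def
    using Comp_assoc[OF u R1(1) S(1)] Comp_assoc[OF d(2) R1(3) S(1)] R1(4) by simp
  have wv: "w \<cdot> v = f' \<cdot> d"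
    unfolding w_def f'_def S(4)
    using Comp_assoc[OF v R2(1) S(3)] Comp_assoc[OF d(2) R2(3) S(3)] R2(4) by simp
  have w_u: "w \<cdot> (u \<cdot> x) = f \<cdot> (d \<cdot> x)" and w_v: "w \<cdot> (v \<cdot> x) = f' \<cdot> (d \<cdot> x)" if x: "x \<in> hom C W D" for x W
    using Comp_eq_assoc[OF wu u w(1) x] Comp_eq_assoc[OF wv v w(1) x]
      Comp_assoc[OF x d(2) f] Comp_assoc[OF x d(2) f'] by simp_all
  have "f \<cdot> (d \<cdot> e) = f' \<cdot> (d \<cdot> e)"
    using w_u[OF e] w_v[OF e] uv by simp
  then have "f \<cdot> (d \<cdot> b) = f' \<cdot> (d \<cdot> b)"
    by (rule dominion[OF f f'])
  then have "w \<cdot> (u \<cdot> b) = w \<cdot> (v \<cdot> b)"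
    using w_u[OF b] w_v[OF b] by simp
  then have "u \<cdot> b = v \<cdot> b"
    by (rule monoD[OF w(2,1) Comp_in_hom[OF b u] Comp_in_hom[OF b v]])
  then have "u = v"
    by (rule generated[OF u v uv])
  show ?thesis
  proof (rule epiI[OF e])
    fix Z g g' assume g: "g \<in> hom C D Z" and g': "g' \<in> hom C D Z" and eq: "g \<cdot> e = g' \<cdot> e"
    obtain h where "h \<cdot> u = g" "h \<cdot> v = g'"
      using cokernel_pairD(4)[OF Q e g g' eq] by blast
    then show "g = g'"
      using \<open>u = v\<close> by simp
  qed
qed

text \<open>
  The cokernel pair of \<open>m\<close> is the directed colimit of the cokernel pairs of the arrows \<open>m \<cdot> t j\<close>.
  As \<open>g\<close> is finitely presentable, the two copies of \<open>b\<close> that agree in the colimit already agree at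
  some stage, hence under any two arrows that agree on the \<open>m \<cdot> t j\<close> of that stage.
\<close>

lemma dominion_finitary:
  assumes m: "m \<in> hom C A B" and P: "cokernel_pair C m P p q"
    and F: "directed_diagram U C I r F" and A: "is_colimit (poset_cat I r) C F A t"
    and g: "g \<in> G" and b: "b \<in> hom C g B" and eq: "p \<cdot> b = q \<cdot> b"
  obtains j where "j \<in> I"
    and "\<And>Z f f'. \<lbrakk>f \<in> hom C B Z; f' \<in> hom C B Z; f \<cdot> (m \<cdot> t j) = f' \<cdot> (m \<cdot> t j)\<rbrakk> \<Longrightarrow> f \<cdot> b = f' \<cdot> b"
proof -
  note dF = directed_diagramD[OF F]
  note dr = directed_posetD[OF dF(2)]
  note t = diagram_cocone[OF A]
  define a where "a j = m \<cdot> t j" for j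
  have a: "a j \<in> hom C (on_Obj F j) B" if "j \<in> I" for j
    unfolding a_def using Comp_in_hom[OF t(2)[OF that] m] .
  have a_trans: "a k \<cdot> on_Arr F (j, k) = a j" if "(j, k) \<in> r" for j k
    using Comp_assoc[OF diagram_functorD(2)[OF F that] t(2) m] dr(2)[OF that] t(3)[OF that]
    by (simp add: a_def)
  have "\<exists>P p q. cokernel_pair C (a j) P p q" if "j \<in> I" for j
    using cokernel_pair_exists[OF a[OF that]] by metis
  then obtain P' p' q' where "\<And>j. j \<in> I \<Longrightarrow> cokernel_pair C (a j) (P' j) (p' j) (q' j)"
    by metis
  note P' = this and p' = cokernel_pairD(1)[OF this a] and q' = cokernel_pairD(2)[OF this a]
    and pq' = cokernel_pairD(3)[OF this a] and desc = cokernel_pairD(4)[OF this a]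
    and eqI = cokernel_pair_eqI[OF this a]
  note p = cokernel_pairD(1)[OF P m] and q = cokernel_pairD(2)[OF P m]
  have later: "f \<cdot> a j = f' \<cdot> a j"
    if jk: "(j, k) \<in> r" and f: "f \<in> hom C B Z" "f' \<in> hom C B Z" "f \<cdot> a k = f' \<cdot> a k" for j k f f' Z
  proof -
    have I: "j \<in> I" "k \<in> I"
      using dr(2)[OF jk] by auto
    note Fjk = diagram_functorD(2)[OF F jk]
    have "f \<cdot> a k \<cdot> on_Arr F (j, k) = f' \<cdot> a k \<cdot> on_Arr F (j, k)"
      using f(3) by simp
    then show ?thesis
      using Comp_assoc[OF Fjk a[OF I(2)] f(1)] Comp_assoc[OF Fjk a[OF I(2)] f(2)] a_trans[OF jk] by simp
  qed
  have "\<exists>h. (j, k) \<in> r \<longrightarrow> h \<in> hom C (P' j) (P' k) \<and> h \<cdot> p' j = p' k \<and> h \<cdot> q' j = q' k" for j k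
  proof (cases "(j, k) \<in> r")
    case True
    then have I: "j \<in> I" "k \<in> I"
      using dr(2)[OF True] by auto
    show ?thesis
      using desc[OF I(1) I(1) p'[OF I(2) I(2)] q'[OF I(2) I(2)]
          later[OF True p'[OF I(2) I(2)] q'[OF I(2) I(2)] pq'[OF I(2) I(2)]]] by blast
  qed simp
  then obtain \<tau> where "\<And>j k. (j, k) \<in> r \<longrightarrow>
      \<tau> j k \<in> hom C (P' j) (P' k) \<and> \<tau> j k \<cdot> p' j = p' k \<and> \<tau> j k \<cdot> q' j = q' k"
    by metis
  then have \<tau>: "\<tau> j k \<in> hom C (P' j) (P' k)" "\<tau> j k \<cdot> p' j = p' k" "\<tau> j k \<cdot> q' j = q' k"
    if "(j, k) \<in> r" for j k
    using that by simp_all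
  define H where "H = \<lparr>on_Obj = P', on_Arr = \<lambda>(j, k). \<tau> j k\<rparr>"
  have H_simps: "on_Obj H = P'" "on_Arr H (j, k) = \<tau> j k" for j k
    by (simp_all add: H_def)
  have H: "is_functor (poset_cat I r) C H"
    unfolding is_functor_def
  proof (intro conjI ballI impI)
    fix j assume "j \<in> Obj (poset_cat I r)"
    then have j: "j \<in> I" by simp
    show "on_Obj H j \<in> Obj C"
      using hom_Obj(2)[OF p'[OF j j]] by (simp add: H_simps)
    note Ide = Ide_in_hom[OF hom_Obj(2)[OF p'[OF j j]]]
    have "\<tau> j j = Ide C (P' j)"
      by (rule eqI[OF j j \<tau>(1)[OF dr(1)[OF j]] Ide])
        (use \<tau>[OF dr(1)[OF j]] Ide_Comp[OF p'[OF j j]] Ide_Comp[OF q'[OF j j]] in simp_all)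
    then show "on_Arr H (Ide (poset_cat I r) j) = Ide C (on_Obj H j)"
      by (simp add: H_simps)
  next
    fix x assume "x \<in> Arr (poset_cat I r)"
    then show "on_Arr H x \<in> hom C (on_Obj H (Dom (poset_cat I r) x)) (on_Obj H (Cod (poset_cat I r) x))"
      using \<tau>(1) by (cases x) (simp add: H_simps)
  next
    fix x y assume "x \<in> Arr (poset_cat I r)" "y \<in> Arr (poset_cat I r)"
      "Cod (poset_cat I r) x = Dom (poset_cat I r) y"
    then obtain j k l where xy: "x = (j, k)" "y = (k, l)" "(j, k) \<in> r" "(k, l) \<in> r"
      by (cases x; cases y) auto
    have j: "j \<in> I"
      using dr(2)[OF xy(3)] by simp
    note jl = dr(3)[OF xy(3,4)]
    have "\<tau> j l = \<tau> k l \<cdot> \<tau> j k"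
    proof (rule eqI[OF j j \<tau>(1)[OF jl] Comp_in_hom[OF \<tau>(1)[OF xy(3)] \<tau>(1)[OF xy(4)]]])
      show "\<tau> j l \<cdot> p' j = \<tau> k l \<cdot> \<tau> j k \<cdot> p' j"
        using Comp_assoc[OF p'[OF j j] \<tau>(1)[OF xy(3)] \<tau>(1)[OF xy(4)]]
          \<tau>(2)[OF jl] \<tau>(2)[OF xy(3)] \<tau>(2)[OF xy(4)] by simp
      show "\<tau> j l \<cdot> q' j = \<tau> k l \<cdot> \<tau> j k \<cdot> q' j"
        using Comp_assoc[OF q'[OF j j] \<tau>(1)[OF xy(3)] \<tau>(1)[OF xy(4)]]
          \<tau>(3)[OF jl] \<tau>(3)[OF xy(3)] \<tau>(3)[OF xy(4)] by simp
    qed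
    then show "on_Arr H (y \<cdot>\<^bsub>poset_cat I r\<^esub> x) = on_Arr H y \<cdot> on_Arr H x"
      by (simp add: xy H_simps)
  qed
  have dH: "directed_diagram U C I r H"
    using dF H by (simp add: directed_diagram_def)
  have "\<exists>h. h \<in> hom C (P' j) P \<and> h \<cdot> p' j = p \<and> h \<cdot> q' j = q" if j: "j \<in> I" for j
  proof -
    have "p \<cdot> a j = q \<cdot> a j"
      using Comp_eq_assoc[OF cokernel_pairD(3)[OF P m] m p t(2)[OF j]] Comp_assoc[OF t(2)[OF j] m q]
      by (simp add: a_def)
    from desc[OF j j p q this] show ?thesis
      by blast
  qed
  then obtain s where s: "\<And>j. j \<in> I \<Longrightarrow> s j \<in> hom C (P' j) P" "\<And>j. j \<in> I \<Longrightarrow> s j \<cdot> p' j = p"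
      "\<And>j. j \<in> I \<Longrightarrow> s j \<cdot> q' j = q"
    by metis
  have lim: "is_colimit (poset_cat I r) C H P s"
    unfolding is_colimit_def
  proof (intro conjI allI impI)
    show "is_cocone (poset_cat I r) C H P s"
      unfolding is_cocone_def
    proof (intro conjI ballI)
      show "P \<in> Obj C"
        using hom_Obj(2)[OF p] .
      show "s j \<in> hom C (on_Obj H j) P" if "j \<in> Obj (poset_cat I r)" for j
        using s(1) that by (simp add: H_simps)
      fix x assume "x \<in> Arr (poset_cat I r)"
      then obtain j k where x: "x = (j, k)" "(j, k) \<in> r"
        by (cases x) auto
      have I: "j \<in> I" "k \<in> I"
        using dr(2)[OF x(2)] by auto
      have "s k \<cdot> \<tau> j k = s j"
      proof (rule eqI[OF I(1) I(1) Comp_in_hom[OF \<tau>(1)[OF x(2)] s(1)[OF I(2)]] s(1)[OF I(1)]])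
        show "s k \<cdot> \<tau> j k \<cdot> p' j = s j \<cdot> p' j"
          using Comp_assoc[OF p'[OF I(1) I(1)] \<tau>(1)[OF x(2)] s(1)[OF I(2)]] \<tau>(2)[OF x(2)]
            s(2)[OF I(1)] s(2)[OF I(2)] by simp
        show "s k \<cdot> \<tau> j k \<cdot> q' j = s j \<cdot> q' j"
          using Comp_assoc[OF q'[OF I(1) I(1)] \<tau>(1)[OF x(2)] s(1)[OF I(2)]] \<tau>(3)[OF x(2)]
            s(3)[OF I(1)] s(3)[OF I(2)] by simp
      qed
      then show "s (Cod (poset_cat I r) x) \<cdot> on_Arr H x = s (Dom (poset_cat I r) x)"
        by (simp add: x H_simps)
    qed
  next
    fix Y c assume c: "is_cocone (poset_cat I r) C H Y c"
    have c_hom: "c j \<in> hom C (P' j) Y" if "j \<in> I" for j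
      using c that unfolding is_cocone_def by (simp add: H_simps)
    have c_trans: "c k \<cdot> \<tau> j k = c j" if "(j, k) \<in> r" for j k
      using c that unfolding is_cocone_def by (force simp: H_simps)
    obtain j0 where j0: "j0 \<in> I"
      using dr(5) by blast
    \<comment> \<open>All \<open>c j \<cdot> p' j\<close> coincide, as the poset is directed.\<close>
    define f where "f = c j0 \<cdot> p' j0"
    define f' where "f' = c j0 \<cdot> q' j0"
    have step: "c k \<cdot> p' k = c j \<cdot> p' j" "c k \<cdot> q' k = c j \<cdot> q' j" if jk: "(j, k) \<in> r" for j k
    proof -
      have I: "j \<in> I" "k \<in> I"
        using dr(2)[OF jk] by auto
      show "c k \<cdot> p' k = c j \<cdot> p' j" "c k \<cdot> q' k = c j \<cdot> q' j"
        using Comp_eq_assoc[OF c_trans[OF jk] \<tau>(1)[OF jk] c_hom[OF I(2)] p'[OF I(1) I(1)]]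
          Comp_eq_assoc[OF c_trans[OF jk] \<tau>(1)[OF jk] c_hom[OF I(2)] q'[OF I(1) I(1)]]
          \<tau>(2,3)[OF jk] by simp_all
    qed
    have cf: "c j \<cdot> p' j = f" "c j \<cdot> q' j = f'" if j: "j \<in> I" for j
    proof -
      obtain k where "(j, k) \<in> r" "(j0, k) \<in> r"
        using dr(4)[OF j j0] by blast
      then show "c j \<cdot> p' j = f" "c j \<cdot> q' j = f'"
        using step[of j k] step[of j0 k] by (simp_all add: f_def f'_def)
    qed
    have f: "f \<in> hom C B Y" and f': "f' \<in> hom C B Y"
      unfolding f_def f'_def
      using Comp_in_hom[OF p'[OF j0 j0] c_hom[OF j0]] Comp_in_hom[OF q'[OF j0 j0] c_hom[OF j0]] .
    have "f \<cdot> m = f' \<cdot> m"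
    proof (rule colimit_eqI[OF A dF(4,3) Comp_in_hom[OF m f] Comp_in_hom[OF m f']])
      fix j assume "j \<in> Obj (poset_cat I r)"
      then have j: "j \<in> I" by simp
      have "f \<cdot> a j = f' \<cdot> a j"
        using Comp_assoc[OF a[OF j] p'[OF j j] c_hom[OF j]] Comp_assoc[OF a[OF j] q'[OF j j] c_hom[OF j]]
          pq'[OF j j] cf[OF j] by simp
      then show "f \<cdot> m \<cdot> t j = f' \<cdot> m \<cdot> t j"
        using Comp_assoc[OF t(2)[OF j] m f] Comp_assoc[OF t(2)[OF j] m f'] by (simp add: a_def)
    qed
    then obtain h where h: "h \<in> hom C P Y" "h \<cdot> p = f" "h \<cdot> q = f'"
      using cokernel_pairD(4)[OF P m f f'] by blast
    show "\<exists>!h. h \<in> hom C P Y \<and> (\<forall>j\<in>Obj (poset_cat I r). h \<cdot> s j = c j)"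
    proof (rule ex1I[of _ h], intro conjI ballI h(1))
      fix j assume "j \<in> Obj (poset_cat I r)"
      then have j: "j \<in> I" by simp
      show "h \<cdot> s j = c j"
      proof (rule eqI[OF j j Comp_in_hom[OF s(1)[OF j] h(1)] c_hom[OF j]])
        show "h \<cdot> s j \<cdot> p' j = c j \<cdot> p' j"
          using Comp_assoc[OF p'[OF j j] s(1)[OF j] h(1)] s(2)[OF j] h(2) cf(1)[OF j] by simp
        show "h \<cdot> s j \<cdot> q' j = c j \<cdot> q' j"
          using Comp_assoc[OF q'[OF j j] s(1)[OF j] h(1)] s(3)[OF j] h(3) cf(2)[OF j] by simp
      qed
    next
      fix k assume "k \<in> hom C P Y \<and> (\<forall>j\<in>Obj (poset_cat I r). k \<cdot> s j = c j)"
      then have k: "k \<in> hom C P Y" "k \<cdot> s j0 = c j0"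
        using j0 by simp_all
      show "k = h"
      proof (rule cokernel_pair_eqI[OF P m k(1) h(1)])
        show "k \<cdot> p = h \<cdot> p"
          using Comp_eq_assoc[OF k(2) s(1)[OF j0] k(1) p'[OF j0 j0]] s(2)[OF j0] h(2) cf(1)[OF j0] by simp
        show "k \<cdot> q = h \<cdot> q"
          using Comp_eq_assoc[OF k(2) s(1)[OF j0] k(1) q'[OF j0 j0]] s(3)[OF j0] h(3) cf(2)[OF j0] by simp
      qed
    qed
  qed
  obtain j where j: "j \<in> I"
    using dr(5) by blast
  have x: "p' j \<cdot> b \<in> hom C g (on_Obj H j)" and y: "q' j \<cdot> b \<in> hom C g (on_Obj H j)"
    using Comp_in_hom[OF b p'[OF j j]] Comp_in_hom[OF b q'[OF j j]] by (simp_all add: H_simps)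
  have "s j \<cdot> (p' j \<cdot> b) = s j \<cdot> (q' j \<cdot> b)"
    using Comp_eq_assoc[OF s(2)[OF j] p'[OF j j] s(1)[OF j] b]
      Comp_eq_assoc[OF s(3)[OF j] q'[OF j j] s(1)[OF j] b] eq by simp
  then obtain k where k: "(j, k) \<in> r" "\<tau> j k \<cdot> (p' j \<cdot> b) = \<tau> j k \<cdot> (q' j \<cdot> b)"
    using G_eq[OF g dH lim j x y] unfolding H_simps by metis
  have kI: "k \<in> I"
    using dr(2)[OF k(1)] by simp
  have pq: "p' k \<cdot> b = q' k \<cdot> b"
    using k(2) Comp_eq_assoc[OF \<tau>(2)[OF k(1)] p'[OF j j] \<tau>(1)[OF k(1)] b]
      Comp_eq_assoc[OF \<tau>(3)[OF k(1)] q'[OF j j] \<tau>(1)[OF k(1)] b] by simp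
  show thesis
  proof (rule that[OF kI])
    fix Z f f' assume f: "f \<in> hom C B Z" and f': "f' \<in> hom C B Z" and eq: "f \<cdot> (m \<cdot> t k) = f' \<cdot> (m \<cdot> t k)"
    obtain h where h: "h \<in> hom C (P' k) Z" "h \<cdot> p' k = f" "h \<cdot> q' k = f'"
      using desc[OF kI kI f f'] eq unfolding a_def by blast
    show "f \<cdot> b = f' \<cdot> b"
      using Comp_eq_assoc[OF h(2) p'[OF kI kI] h(1) b] Comp_eq_assoc[OF h(3) q'[OF kI kI] h(1) b] pq
      by simp
  qed
qed

text \<open>
  Write \<open>A\<close> as a directed colimit of generators and take a stage \<open>j\<close> at which \<open>b\<close> already lies in
  the dominion. Let \<open>A'\<close> be the image of this stage in \<open>A\<close>, and \<open>D\<close> the image of \<open>A' + g\<close> in \<open>B\<close>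
  under \<open>m\<close> and \<open>b\<close>. The monomorphism \<open>A' \<rightarrow> D\<close> is an epimorphism between finitely generated objects, hence
  an isomorphism by WES; so \<open>b\<close>, which factors through \<open>D\<close>, factors through \<open>A'\<close>.
\<close>

lemma factor_generalised_element:
  assumes AP: "amalgamation_property C" and WES: "WES U C"
    and m: "monomorphism C m" "m \<in> hom C A B" and P: "cokernel_pair C m P p q"
    and g: "g \<in> G" and b: "b \<in> hom C g B" and eq: "p \<cdot> b = q \<cdot> b"
  obtains a where "a \<in> hom C g A" "m \<cdot> a = b"
proof -
  obtain I r F t where F: "directed_diagram U C I r F" and FG: "\<And>i. i \<in> I \<Longrightarrow> on_Obj F i \<in> G"
    and A: "is_colimit (poset_cat I r) C F A t"
    using G_directed_colimit[OF hom_Obj(1)[OF m(2)]] by blast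
  obtain j where j: "j \<in> I" and dom: "\<And>Z f f'. \<lbrakk>f \<in> hom C B Z; f' \<in> hom C B Z;
      f \<cdot> (m \<cdot> t j) = f' \<cdot> (m \<cdot> t j)\<rbrakk> \<Longrightarrow> f \<cdot> b = f' \<cdot> b"
    using dominion_finitary[OF m(2) P F A g b eq] by metis
  note tj = diagram_cocone(2)[OF A j]
  obtain A' c i where c: "c \<in> hom C (on_Obj F j) A'" "strong_epi C c"
    and i: "i \<in> hom C A' A" "monomorphism C i" and ic: "i \<cdot> c = t j"
    using image_factorisation[OF tj] .
  have A': "finitely_generated U C A'"
    using strong_quotient_finitely_generated[OF G_finitely_generated[OF FG[OF j]] c(2,1)] .
  have mi: "m \<cdot> i \<in> hom C A' B" "monomorphism C (m \<cdot> i)"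
    using Comp_in_hom[OF i(1) m(2)] mono_Comp[OF i(2,1) m] .
  obtain S k l where k: "k \<in> hom C A' S" and l: "l \<in> hom C g S"
    and desc: "\<And>Z f g'. \<lbrakk>f \<in> hom C A' Z; g' \<in> hom C g Z\<rbrakk> \<Longrightarrow> \<exists>h\<in>hom C S Z. h \<cdot> k = f \<and> h \<cdot> l = g'"
    and S_eqI: "\<And>Z f f'. \<lbrakk>f \<in> hom C S Z; f' \<in> hom C S Z; f \<cdot> k = f' \<cdot> k; f \<cdot> l = f' \<cdot> l\<rbrakk> \<Longrightarrow> f = f'"
    by (rule coproduct[OF hom_Obj(1)[OF i(1)] G_Obj[OF g]]) (rule that; assumption)
  have S: "finitely_generated U C S"
    by (rule coproduct_finitely_generated[OF A' G_finitely_generated[OF g] k l desc S_eqI])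
  obtain h where h: "h \<in> hom C S B" "h \<cdot> k = m \<cdot> i" "h \<cdot> l = b"
    using desc[OF mi(1) b] by blast
  obtain D c' d where c': "c' \<in> hom C S D" "strong_epi C c'"
    and d: "d \<in> hom C D B" "monomorphism C d" and dc': "d \<cdot> c' = h"
    using image_factorisation[OF h(1)] .
  have D: "finitely_generated U C D"
    using strong_quotient_finitely_generated[OF S c'(2,1)] .
  define e where "e = c' \<cdot> k"
  define b' where "b' = c' \<cdot> l"
  have e: "e \<in> hom C A' D" and b': "b' \<in> hom C g D"
    unfolding e_def b'_def using Comp_in_hom[OF k c'(1)] Comp_in_hom[OF l c'(1)] .
  have de: "d \<cdot> e = m \<cdot> i" and db': "d \<cdot> b' = b"
    unfolding e_def b'_def
    using Comp_eq_assoc[OF dc' c'(1) d(1) k] Comp_eq_assoc[OF dc' c'(1) d(1) l] h(2,3) by simp_all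
  have e_mono: "monomorphism C e"
    by (rule mono_right_factor[OF _ e d(1)]) (use de mi(2) in simp)
  have "epimorphism C e"
  proof (rule epi_into_dominion[OF AP e d(2,1) b'])
    fix Z u v
    assume u: "u \<in> hom C D Z" and v: "v \<in> hom C D Z" and ue: "u \<cdot> e = v \<cdot> e" and ub: "u \<cdot> b' = v \<cdot> b'"
    have "u \<cdot> c' = v \<cdot> c'"
    proof (rule S_eqI[OF Comp_in_hom[OF c'(1) u] Comp_in_hom[OF c'(1) v]])
      show "u \<cdot> c' \<cdot> k = v \<cdot> c' \<cdot> k"
        using ue Comp_assoc[OF k c'(1) u] Comp_assoc[OF k c'(1) v] by (simp add: e_def)
      show "u \<cdot> c' \<cdot> l = v \<cdot> c' \<cdot> l"
        using ub Comp_assoc[OF l c'(1) u] Comp_assoc[OF l c'(1) v] by (simp add: b'_def)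
    qed
    then show "u = v"
      by (rule epiD[OF strong_epi_hom(1)[OF c'(2,1)] c'(1) u v])
  next
    fix Z f f'
    assume f: "f \<in> hom C B Z" and f': "f' \<in> hom C B Z" and eq: "f \<cdot> (d \<cdot> e) = f' \<cdot> (d \<cdot> e)"
    have mt: "m \<cdot> t j = m \<cdot> i \<cdot> c"
      using Comp_assoc[OF c(1) i(1) m(2)] ic by simp
    have "f \<cdot> (m \<cdot> i) \<cdot> c = f' \<cdot> (m \<cdot> i) \<cdot> c"
      using eq by (simp add: de)
    then have "f \<cdot> (m \<cdot> t j) = f' \<cdot> (m \<cdot> t j)"
      unfolding mt using Comp_assoc[OF c(1) mi(1) f] Comp_assoc[OF c(1) mi(1) f'] by simp
    then show "f \<cdot> (d \<cdot> b') = f' \<cdot> (d \<cdot> b')"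
      unfolding db' by (rule dom[OF f f'])
  qed
  then have "extremal_epi C e"
    using WES A' D hom_ArrD[OF e] unfolding WES_def by simp
  then have "isomorphism C e"
    by (rule iso_if_mono_extremal_epi[OF _ e_mono e])
  then obtain n where n: "n \<in> hom C D A'" "e \<cdot> n = Ide C D"
    using hom_ArrD[OF e] unfolding isomorphism_def by auto
  have nb: "n \<cdot> b' \<in> hom C g A'"
    using Comp_in_hom[OF b' n(1)] .
  have "m \<cdot> (i \<cdot> (n \<cdot> b')) = m \<cdot> i \<cdot> (n \<cdot> b')"
    using Comp_assoc[OF nb i(1) m(2)] by simp
  also have "\<dots> = d \<cdot> (e \<cdot> (n \<cdot> b'))"
    using Comp_eq_assoc[OF de e d(1) nb] by simp
  also have "\<dots> = d \<cdot> b'"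
    using Comp_eq_assoc[OF n(2,1) e b'] Ide_Comp[OF b'] by simp
  finally have "m \<cdot> (i \<cdot> (n \<cdot> b')) = b"
    using db' by simp
  then show thesis
    using that[OF Comp_in_hom[OF nb i(1)]] by simp
qed

text \<open>
  An object is a colimit of generators, and factorisations through a monomorphism are unique, so
  those obtained on the generators fit together.
\<close>

lemma mono_regular:
  assumes AP: "amalgamation_property C" and WES: "WES U C" and mono: "monomorphism C m"
  shows "regular_mono C m"
proof -
  define A B where "A = Dom C m" and "B = Cod C m"
  have m: "m \<in> hom C A B"
    using mono by (simp add: A_def B_def hom_def monomorphism_def)
  obtain P p q where P: "cokernel_pair C m P p q"
    using cokernel_pair_exists[OF m] .
  note p = cokernel_pairD(1)[OF P m] and q = cokernel_pairD(2)[OF P m]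
  have factor: "\<exists>k\<in>hom C W A. m \<cdot> k = h" if h: "h \<in> hom C W B" and eq: "p \<cdot> h = q \<cdot> h" for W h
  proof -
    obtain I r F t where F: "directed_diagram U C I r F" and FG: "\<And>i. i \<in> I \<Longrightarrow> on_Obj F i \<in> G"
      and W: "is_colimit (poset_cat I r) C F W t"
      using G_directed_colimit[OF hom_Obj(1)[OF h]] by blast
    note t = diagram_cocone[OF W]
    have "\<exists>a. a \<in> hom C (on_Obj F i) A \<and> m \<cdot> a = h \<cdot> t i" if i: "i \<in> I" for i
    proof -
      have "p \<cdot> (h \<cdot> t i) = q \<cdot> (h \<cdot> t i)"
        using Comp_eq_assoc[OF eq h p t(2)[OF i]] Comp_assoc[OF t(2)[OF i] h q] by simp
      then show ?thesis
        using factor_generalised_element[OF AP WES mono m P FG[OF i] Comp_in_hom[OF t(2)[OF i] h]]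
        by metis
    qed
    then obtain a where a: "\<And>i. i \<in> I \<Longrightarrow> a i \<in> hom C (on_Obj F i) A" "\<And>i. i \<in> I \<Longrightarrow> m \<cdot> a i = h \<cdot> t i"
      by metis
    have "is_cocone (poset_cat I r) C F A a"
      unfolding is_cocone_def
    proof (intro conjI ballI)
      show "A \<in> Obj C"
        using hom_Obj(1)[OF m] .
      show "a i \<in> hom C (on_Obj F i) A" if "i \<in> Obj (poset_cat I r)" for i
        using a(1) that by simp
      fix u assume "u \<in> Arr (poset_cat I r)"
      then obtain i j where u: "u = (i, j)" "(i, j) \<in> r"
        by (cases u) auto
      have ij: "i \<in> I" "j \<in> I"
        using directed_posetD(2)[OF directed_diagramD(2)[OF F] u(2)] by auto
      note Fij = diagram_functorD(2)[OF F u(2)]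
      have "m \<cdot> (a j \<cdot> on_Arr F (i, j)) = m \<cdot> a i"
        using Comp_eq_assoc[OF a(2)[OF ij(2)] a(1)[OF ij(2)] m Fij]
          Comp_assoc[OF Fij t(2)[OF ij(2)] h] t(3)[OF u(2)] a(2)[OF ij(1)] by simp
      then have "a j \<cdot> on_Arr F (i, j) = a i"
        by (rule monoD[OF mono m Comp_in_hom[OF Fij a(1)[OF ij(2)]] a(1)[OF ij(1)]])
      then show "a (Cod (poset_cat I r) u) \<cdot> on_Arr F u = a (Dom (poset_cat I r) u)"
        by (simp add: u)
    qed
    then obtain k where k: "k \<in> hom C W A" "\<And>i. i \<in> I \<Longrightarrow> k \<cdot> t i = a i"
      using colimit_desc[OF W] by (metis poset_cat_simps(1))
    have "m \<cdot> k = h"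
    proof (rule colimit_eqI[OF W directed_diagramD(4,3)[OF F] Comp_in_hom[OF k(1) m] h])
      fix i assume "i \<in> Obj (poset_cat I r)"
      then have i: "i \<in> I" by simp
      show "m \<cdot> k \<cdot> t i = h \<cdot> t i"
        using Comp_assoc[OF t(2)[OF i] k(1) m] k(2)[OF i] a(2)[OF i] by simp
    qed
    then show ?thesis
      using k(1) by blast
  qed
  have "is_equaliser C m p q"
    unfolding is_equaliser_def
  proof (intro conjI allI ballI impI)
    show "p \<in> Arr C" "q \<in> Arr C" "Dom C p = Dom C q" "Cod C p = Cod C q" "m \<in> hom C (Dom C m) (Dom C p)"
      using hom_ArrD[OF p] hom_ArrD[OF q] m by (simp_all add: A_def)
    show "p \<cdot> m = q \<cdot> m"
      using cokernel_pairD(3)[OF P m] .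
    fix W h assume "h \<in> hom C W (Dom C p)" and eq: "p \<cdot> h = q \<cdot> h"
    then have h: "h \<in> hom C W B"
      using hom_ArrD[OF p] by simp
    obtain k where k: "k \<in> hom C W A" "m \<cdot> k = h"
      using factor[OF h eq] by blast
    show "\<exists>!k. k \<in> hom C W (Dom C m) \<and> m \<cdot> k = h"
    proof (rule ex1I[of _ k])
      show "k \<in> hom C W (Dom C m) \<and> m \<cdot> k = h"
        using k by (simp add: A_def)
      show "k' = k" if "k' \<in> hom C W (Dom C m) \<and> m \<cdot> k' = h" for k'
        using monoD[OF mono m _ k(1), of k'] that k(2) by (simp add: A_def)
    qed
  qed
  then show ?thesis
    unfolding regular_mono_def by blast
qed

end

theorem theorem6p5:
  fixes U :: "'u itself" and C :: "('o, 'm) cat"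
  assumes "universe U"
    and "category C"
    and "locally_small U C"
    and "locally_finitely_presentable U C"
    and "amalgamation_property C"
    and "WES U C"
  shows "SES C"
proof -
  interpret category C by fact
  obtain G where G: "small U G" "\<forall>X\<in>G. finitely_presentable U C X"
      "\<forall>X\<in>Obj C. \<exists>I r F t. directed_diagram U C I r F \<and> (\<forall>i\<in>I. on_Obj F i \<in> G) \<and>
        is_colimit (poset_cat I r) C F X t"
    using assms(4) unfolding locally_finitely_presentable_def by blast
  interpret lfp_category C U G
  proof unfold_locales
    show "universe U" "locally_small U C" "small U G"
      by fact+
    show "cocomplete U C"
      using assms(4) by (simp add: locally_finitely_presentable_def)
    show "finitely_presentable U C g" if "g \<in> G" for g
      using G(2) that by blast
    show "\<exists>I r F t. directed_diagram U C I r F \<and> (\<forall>i\<in>I. on_Obj F i \<in> G) \<and>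
        is_colimit (poset_cat I r) C F X t" if "X \<in> Obj C" for X
      using G(3) that by blast
  qed
  show ?thesis
    unfolding SES_def using mono_regular assms(5,6) by blast
qed

end
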